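(* The categories $\mathbf{Spl}$ and $\mathbf{Spl}^{\mathrm{ab}}$ are equivalent. Thus, two q-split nil$_2$-groups are isomorphic in $\mathbf{Niq}$ if and only if they are similar.
   Context: Groups are written additively; $[a,b]=-a-b+a+b$. A nil$_2$-group is a group $G$ with $[[G,G],G]=0$; $G^{\mathrm{ab}}=G/[G,G]$. For a map $f:G\to H$ put $(a\mid b)_f:=-(f(a)+f(b))+f(a+b)$. The map $f$ is weakly quadratic if for all $a,b,c\in G$ the element $(a\mid b)_f$ commutes with $f(c)$ and is additive in $a$ and in $b$; it is quadratic if moreover $(a\mid b)_f$ is central in $H$. A q-map is a weakly quadratic map $f:G\to H$ between nil$_2$-groups with $(a\mid b)_f\in[H,H]$ for all $a,b$. $\mathbf{Niq}$ is the category of nil$_2$-groups and q-maps. A nil$_2$-group $G$ is q-split if the quotient map $G\to G^{\mathrm{ab}}$ has a quadratic section (such a section is then a q-map). Two nil$_2$-groups are similar if they have isomorphic abelianizations and isomorphic commutator subgroups. For abelian groups $A,B$, $H^2(A,B)$ is group cohomology with trivial action, $H^2_b(A,B)\subseteq H^2(A,B)$ is the subgroup generated by classes of bilinear 2-cocycles, $\Lambda^2(A)$ is the quotient of $A\otimes A$ by the subgroup generated by the $a\otimes a$, and $\mu:H^2(A,B)\to\mathrm{Hom}(\Lambda^2(A),B)$ sends the class of a central extension $0\to B\xrightarrow{i}E\xrightarrow{p}A\to0$ to the homomorphism determined by $i(\mu(p(x)\wedge p(y)))=[x,y]$. $\mathbf{Niq}^{\mathrm{ab}}$ is the category whose objects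 are triples $(A,B,e)$ with $A,B$ abelian groups and $e\in H^2(A,B)$ such that $\mu(e)$ is an epimorphism; a morphism $(A,B,e)\to(A',B',e')$ is a pair of homomorphisms $f:A\to A'$, $g:B\to B'$ with $f^*(e')-g_*(e)\in H^2_b(A,B')$. $\mathbf{Spl}^{\mathrm{ab}}$ is the full subcategory of $\mathbf{Niq}^{\mathrm{ab}}$ on the objects $(A,B,e)$ with $e\in H^2_b(A,B)$. $\mathbf{Spl}$ is the full subcategory of $\mathbf{Ab}\times\mathbf{Ab}$ on the pairs $(A,B)$ of abelian groups for which there exists a homomorphism $f:A\otimes A\to B$ such that $f^a:\Lambda^2(A)\to B$, $f^a(x,y):=f(x,y)-f(y,x)$, is an epimorphism. *)

theory Defs
  imports "HOL-Algebra.Free_Abelian_Groups" "HOL-Library.FuncSet"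
begin

section \<open>Categories\<close>

text \<open>Hom-sets of different pairs of objects may overlap, so identities, composition and
  the arrow part of a functor take the objects as additional arguments:
  \<open>cmp C x y z g f\<close> is the composite of \<open>f : x \<rightarrow> y\<close> and \<open>g : y \<rightarrow> z\<close>.\<close>

record ('o, 'm) cat =
  obj :: "'o set"
  mor :: "'o \<Rightarrow> 'o \<Rightarrow> 'm set"
  ident :: "'o \<Rightarrow> 'm"
  cmp :: "'o \<Rightarrow> 'o \<Rightarrow> 'o \<Rightarrow> 'm \<Rightarrow> 'm \<Rightarrow> 'm"

locale category =
  fixes C :: "('o, 'm) cat"
  assumes ident_mor: "x \<in> obj C \<Longrightarrow> ident C x \<in> mor C x x"
    and cmp_mor: "\<lbrakk>x \<in> obj C; y \<in> obj C; z \<in> obj C; f \<in> mor C x y; g \<in> mor C y z\<rbrakk>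
      \<Longrightarrow> cmp C x y z g f \<in> mor C x z"
    and cmp_ident_left: "\<lbrakk>x \<in> obj C; y \<in> obj C; f \<in> mor C x y\<rbrakk>
      \<Longrightarrow> cmp C x y y (ident C y) f = f"
    and cmp_ident_right: "\<lbrakk>x \<in> obj C; y \<in> obj C; f \<in> mor C x y\<rbrakk>
      \<Longrightarrow> cmp C x x y f (ident C x) = f"
    and cmp_assoc: "\<lbrakk>w \<in> obj C; x \<in> obj C; y \<in> obj C; z \<in> obj C;
        f \<in> mor C w x; g \<in> mor C x y; h \<in> mor C y z\<rbrakk>
      \<Longrightarrow> cmp C w x z (cmp C x y z h g) f = cmp C w y z h (cmp C w x y g f)"

definition inverse_mors :: "('o, 'm) cat \<Rightarrow> 'o \<Rightarrow> 'o \<Rightarrow> 'm \<Rightarrow> 'm \<Rightarrow> bool" where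
  "inverse_mors C x y f g \<longleftrightarrow> f \<in> mor C x y \<and> g \<in> mor C y x \<and>
     cmp C x y x g f = ident C x \<and> cmp C y x y f g = ident C y"

definition isomorphic_in :: "('o, 'm) cat \<Rightarrow> 'o \<Rightarrow> 'o \<Rightarrow> bool" where
  "isomorphic_in C x y \<longleftrightarrow> x \<in> obj C \<and> y \<in> obj C \<and> (\<exists>f g. inverse_mors C x y f g)"

locale cat_functor =
  source: category C + target: category D
  for C :: "('o, 'm) cat" and D :: "('p, 'n) cat" +
  fixes Fo :: "'o \<Rightarrow> 'p" and Fm :: "'o \<Rightarrow> 'o \<Rightarrow> 'm \<Rightarrow> 'n"
  assumes Fo_obj: "x \<in> obj C \<Longrightarrow> Fo x \<in> obj D"
    and Fm_mor: "\<lbrakk>x \<in> obj C; y \<in> obj C; f \<in> mor C x y\<rbrakk> \<Longrightarrow> Fm x y f \<in> mor D (Fo x) (Fo y)"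
    and Fm_ident: "x \<in> obj C \<Longrightarrow> Fm x x (ident C x) = ident D (Fo x)"
    and Fm_cmp: "\<lbrakk>x \<in> obj C; y \<in> obj C; z \<in> obj C; f \<in> mor C x y; g \<in> mor C y z\<rbrakk>
      \<Longrightarrow> Fm x z (cmp C x y z g f) = cmp D (Fo x) (Fo y) (Fo z) (Fm y z g) (Fm x y f)"

definition naturally_isomorphic ::
  "('o, 'm) cat \<Rightarrow> ('p, 'n) cat \<Rightarrow> ('o \<Rightarrow> 'p) \<Rightarrow> ('o \<Rightarrow> 'o \<Rightarrow> 'm \<Rightarrow> 'n)
    \<Rightarrow> ('o \<Rightarrow> 'p) \<Rightarrow> ('o \<Rightarrow> 'o \<Rightarrow> 'm \<Rightarrow> 'n) \<Rightarrow> bool" where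
  "naturally_isomorphic C D Fo Fm Go Gm \<longleftrightarrow> (\<exists>\<eta>.
     (\<forall>x \<in> obj C. \<exists>g. inverse_mors D (Fo x) (Go x) (\<eta> x) g) \<and>
     (\<forall>x \<in> obj C. \<forall>y \<in> obj C. \<forall>f \<in> mor C x y.
        cmp D (Fo x) (Fo y) (Go y) (\<eta> y) (Fm x y f)
          = cmp D (Fo x) (Go x) (Go y) (Gm x y f) (\<eta> x)))"

definition equivalent_categories :: "('o, 'm) cat \<Rightarrow> ('p, 'n) cat \<Rightarrow> bool" where
  "equivalent_categories C D \<longleftrightarrow> (\<exists>Fo Fm Go Gm.
     cat_functor C D Fo Fm \<and> cat_functor D C Go Gm \<and>
     naturally_isomorphic C C (\<lambda>x. Go (Fo x)) (\<lambda>x y f. Gm (Fo x) (Fo y) (Fm x y f))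
       (\<lambda>x. x) (\<lambda>x y f. f) \<and>
     naturally_isomorphic D D (\<lambda>x. Fo (Go x)) (\<lambda>x y f. Fm (Go x) (Go y) (Gm x y f))
       (\<lambda>x. x) (\<lambda>x y f. f))"

definition full_subcat :: "('o, 'm) cat \<Rightarrow> 'o set \<Rightarrow> ('o, 'm) cat" where
  "full_subcat C S = C\<lparr>obj := obj C \<inter> S\<rparr>"

definition prod_cat :: "('o, 'm) cat \<Rightarrow> ('p, 'n) cat \<Rightarrow> ('o \<times> 'p, 'm \<times> 'n) cat" where
  "prod_cat C D = \<lparr>
     obj = obj C \<times> obj D,
     mor = (\<lambda>x y. mor C (fst x) (fst y) \<times> mor D (snd x) (snd y)),
     ident = (\<lambda>x. (ident C (fst x), ident D (snd x))),
     cmp = (\<lambda>x y z g f. (cmp C (fst x) (fst y) (fst z) (fst g) (fst f),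
                         cmp D (snd x) (snd y) (snd z) (snd g) (snd f)))\<rparr>"


section \<open>Concrete categories of groups\<close>

text \<open>Groups are multiplicative here, as in HOL-Algebra.
  Arrows are maps in \<open>extensional (carrier G)\<close>, so that they are equal as soon as they agree
  on the carrier. The objects are the groups whose carrier is a subset of a fixed but
  arbitrary type.\<close>

definition concrete_cat :: "'a monoid set \<Rightarrow> ('a monoid \<Rightarrow> 'a monoid \<Rightarrow> ('a \<Rightarrow> 'a) set)
    \<Rightarrow> ('a monoid, 'a \<Rightarrow> 'a) cat" where
  "concrete_cat S M = \<lparr>
     obj = S,
     mor = (\<lambda>G H. M G H \<inter> extensional (carrier G)),
     ident = (\<lambda>G. \<lambda>a \<in> carrier G. a),
     cmp = (\<lambda>G H K g f. compose (carrier G) g f)\<rparr>"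

definition Ab :: "('a monoid, 'a \<Rightarrow> 'a) cat" where
  "Ab = concrete_cat {A. comm_group A} hom"


section \<open>Groups of nilpotency class two and q-maps\<close>

definition group_commutator :: "('a, 'm) monoid_scheme \<Rightarrow> 'a \<Rightarrow> 'a \<Rightarrow> 'a" where
  "group_commutator G a b = inv\<^bsub>G\<^esub> a \<otimes>\<^bsub>G\<^esub> inv\<^bsub>G\<^esub> b \<otimes>\<^bsub>G\<^esub> a \<otimes>\<^bsub>G\<^esub> b"

definition commutator_subgroup :: "('a, 'm) monoid_scheme \<Rightarrow> 'a set \<Rightarrow> 'a set \<Rightarrow> 'a set" where
  "commutator_subgroup G H K = generate G {group_commutator G h k | h k. h \<in> H \<and> k \<in> K}"

text \<open>For \<open>[G,G]\<close> we use the library's \<open>derived G (carrier G)\<close>; its generators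
  \<open>h \<otimes> k \<otimes> inv h \<otimes> inv k\<close> are the elements \<open>group_commutator G (inv h) (inv k)\<close>.\<close>

abbreviation comm_sub :: "('a, 'm) monoid_scheme \<Rightarrow> 'a set" where
  "comm_sub G \<equiv> derived G (carrier G)"

definition nil2_group :: "('a, 'm) monoid_scheme \<Rightarrow> bool" where
  "nil2_group G \<longleftrightarrow> group G \<and> commutator_subgroup G (comm_sub G) (carrier G) = {\<one>\<^bsub>G\<^esub>}"

definition abelianization :: "('a, 'm) monoid_scheme \<Rightarrow> 'a set monoid" where
  "abelianization G = G Mod comm_sub G"

definition cross_effect ::
  "('a, 'm) monoid_scheme \<Rightarrow> ('b, 'n) monoid_scheme \<Rightarrow> ('a \<Rightarrow> 'b) \<Rightarrow> 'a \<Rightarrow> 'a \<Rightarrow> 'b" where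
  "cross_effect G H f a b = inv\<^bsub>H\<^esub> (f a \<otimes>\<^bsub>H\<^esub> f b) \<otimes>\<^bsub>H\<^esub> f (a \<otimes>\<^bsub>G\<^esub> b)"

definition biadditive ::
  "('a, 'm) monoid_scheme \<Rightarrow> ('b, 'n) monoid_scheme \<Rightarrow> ('a \<Rightarrow> 'a \<Rightarrow> 'b) \<Rightarrow> bool" where
  "biadditive G H c \<longleftrightarrow> (\<forall>x \<in> carrier G. \<forall>y \<in> carrier G. \<forall>z \<in> carrier G.
     c (x \<otimes>\<^bsub>G\<^esub> y) z = c x z \<otimes>\<^bsub>H\<^esub> c y z \<and> c x (y \<otimes>\<^bsub>G\<^esub> z) = c x y \<otimes>\<^bsub>H\<^esub> c x z)"

definition weakly_quadratic ::
  "('a, 'm) monoid_scheme \<Rightarrow> ('b, 'n) monoid_scheme \<Rightarrow> ('a \<Rightarrow> 'b) \<Rightarrow> bool" where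
  "weakly_quadratic G H f \<longleftrightarrow> f \<in> carrier G \<rightarrow> carrier H \<and>
     (\<forall>a \<in> carrier G. \<forall>b \<in> carrier G. \<forall>c \<in> carrier G.
        cross_effect G H f a b \<otimes>\<^bsub>H\<^esub> f c = f c \<otimes>\<^bsub>H\<^esub> cross_effect G H f a b) \<and>
     biadditive G H (cross_effect G H f)"

definition quadratic ::
  "('a, 'm) monoid_scheme \<Rightarrow> ('b, 'n) monoid_scheme \<Rightarrow> ('a \<Rightarrow> 'b) \<Rightarrow> bool" where
  "quadratic G H f \<longleftrightarrow> weakly_quadratic G H f \<and>
     (\<forall>a \<in> carrier G. \<forall>b \<in> carrier G. \<forall>h \<in> carrier H.
        cross_effect G H f a b \<otimes>\<^bsub>H\<^esub> h = h \<otimes>\<^bsub>H\<^esub> cross_effect G H f a b)"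

definition q_maps ::
  "('a, 'm) monoid_scheme \<Rightarrow> ('b, 'n) monoid_scheme \<Rightarrow> ('a \<Rightarrow> 'b) set" where
  "q_maps G H = {f. weakly_quadratic G H f \<and>
     (\<forall>a \<in> carrier G. \<forall>b \<in> carrier G. cross_effect G H f a b \<in> comm_sub H)}"

definition Niq :: "('a monoid, 'a \<Rightarrow> 'a) cat" where
  "Niq = concrete_cat {G. nil2_group G} q_maps"

definition q_split :: "('a, 'm) monoid_scheme \<Rightarrow> bool" where
  "q_split G \<longleftrightarrow> (\<exists>s. quadratic (abelianization G) G s \<and>
     (\<forall>X \<in> carrier (abelianization G). comm_sub G #>\<^bsub>G\<^esub> s X = X))"

definition similar_groups :: "('a, 'm) monoid_scheme \<Rightarrow> ('b, 'n) monoid_scheme \<Rightarrow> bool" where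
  "similar_groups G H \<longleftrightarrow> abelianization G \<cong> abelianization H \<and>
     G\<lparr>carrier := comm_sub G\<rparr> \<cong> H\<lparr>carrier := comm_sub H\<rparr>"


section \<open>Tensor square and exterior square of an abelian group\<close>

definition tensor_relations :: "('a, 'm) monoid_scheme \<Rightarrow> ('a \<times> 'a \<Rightarrow>\<^sub>0 int) set" where
  "tensor_relations A =
     {frag_of (x \<otimes>\<^bsub>A\<^esub> y, z) - frag_of (x, z) - frag_of (y, z) | x y z.
        x \<in> carrier A \<and> y \<in> carrier A \<and> z \<in> carrier A} \<union>
     {frag_of (x, y \<otimes>\<^bsub>A\<^esub> z) - frag_of (x, y) - frag_of (x, z) | x y z.
        x \<in> carrier A \<and> y \<in> carrier A \<and> z \<in> carrier A}"

definition tensor_kernel :: "('a, 'm) monoid_scheme \<Rightarrow> ('a \<times> 'a \<Rightarrow>\<^sub>0 int) set" where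
  "tensor_kernel A = generate (free_Abelian_group (carrier A \<times> carrier A)) (tensor_relations A)"

definition tensor_square :: "('a, 'm) monoid_scheme \<Rightarrow> ('a \<times> 'a \<Rightarrow>\<^sub>0 int) set monoid" where
  "tensor_square A = free_Abelian_group (carrier A \<times> carrier A) Mod tensor_kernel A"

definition tensor :: "('a, 'm) monoid_scheme \<Rightarrow> 'a \<Rightarrow> 'a \<Rightarrow> ('a \<times> 'a \<Rightarrow>\<^sub>0 int) set" where
  "tensor A x y = tensor_kernel A #>\<^bsub>free_Abelian_group (carrier A \<times> carrier A)\<^esub> frag_of (x, y)"

definition wedge_kernel :: "('a, 'm) monoid_scheme \<Rightarrow> ('a \<times> 'a \<Rightarrow>\<^sub>0 int) set set" where
  "wedge_kernel A = generate (tensor_square A) {tensor A x x | x. x \<in> carrier A}"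

definition exterior_square ::
  "('a, 'm) monoid_scheme \<Rightarrow> ('a \<times> 'a \<Rightarrow>\<^sub>0 int) set set monoid" where
  "exterior_square A = tensor_square A Mod wedge_kernel A"

definition wedge :: "('a, 'm) monoid_scheme \<Rightarrow> 'a \<Rightarrow> 'a \<Rightarrow> ('a \<times> 'a \<Rightarrow>\<^sub>0 int) set set" where
  "wedge A x y = wedge_kernel A #>\<^bsub>tensor_square A\<^esub> tensor A x y"

text \<open>The homomorphism \<open>f\<^sup>a\<close> on the exterior square induced by \<open>f\<close> on the tensor square.\<close>

definition antisymmetrization ::
  "('a, 'm) monoid_scheme \<Rightarrow> ('b, 'n) monoid_scheme \<Rightarrow> (('a \<times> 'a \<Rightarrow>\<^sub>0 int) set \<Rightarrow> 'b)
    \<Rightarrow> ('a \<times> 'a \<Rightarrow>\<^sub>0 int) set set \<Rightarrow> 'b" where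
  "antisymmetrization A B f = (THE h.
     h \<in> hom (exterior_square A) B \<inter> extensional (carrier (exterior_square A)) \<and>
     (\<forall>x \<in> carrier A. \<forall>y \<in> carrier A.
        h (wedge A x y) = f (tensor A x y) \<otimes>\<^bsub>B\<^esub> inv\<^bsub>B\<^esub> f (tensor A y x)))"


section \<open>Second cohomology with trivial action\<close>

definition cocycles2 ::
  "('a, 'm) monoid_scheme \<Rightarrow> ('b, 'n) monoid_scheme \<Rightarrow> ('a \<times> 'a \<Rightarrow> 'b) monoid" where
  "cocycles2 A B = \<lparr>
     carrier = {c \<in> carrier A \<times> carrier A \<rightarrow>\<^sub>E carrier B.
       \<forall>x \<in> carrier A. \<forall>y \<in> carrier A. \<forall>z \<in> carrier A.
         c (y, z) \<otimes>\<^bsub>B\<^esub> c (x, y \<otimes>\<^bsub>A\<^esub> z) = c (x \<otimes>\<^bsub>A\<^esub> y, z) \<otimes>\<^bsub>B\<^esub> c (x, y)},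
     monoid.mult = (\<lambda>c d. \<lambda>p \<in> carrier A \<times> carrier A. c p \<otimes>\<^bsub>B\<^esub> d p),
     one = (\<lambda>p \<in> carrier A \<times> carrier A. \<one>\<^bsub>B\<^esub>)\<rparr>"

definition coboundaries2 ::
  "('a, 'm) monoid_scheme \<Rightarrow> ('b, 'n) monoid_scheme \<Rightarrow> ('a \<times> 'a \<Rightarrow> 'b) set" where
  "coboundaries2 A B =
     {\<lambda>(x, y) \<in> carrier A \<times> carrier A. h x \<otimes>\<^bsub>B\<^esub> h y \<otimes>\<^bsub>B\<^esub> inv\<^bsub>B\<^esub> h (x \<otimes>\<^bsub>A\<^esub> y) | h.
        h \<in> carrier A \<rightarrow> carrier B}"

definition H2 :: "('a, 'm) monoid_scheme \<Rightarrow> ('b, 'n) monoid_scheme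
    \<Rightarrow> ('a \<times> 'a \<Rightarrow> 'b) set monoid" where
  "H2 A B = cocycles2 A B Mod coboundaries2 A B"

definition coh_class :: "('a, 'm) monoid_scheme \<Rightarrow> ('b, 'n) monoid_scheme
    \<Rightarrow> ('a \<times> 'a \<Rightarrow> 'b) \<Rightarrow> ('a \<times> 'a \<Rightarrow> 'b) set" where
  "coh_class A B c = coboundaries2 A B #>\<^bsub>cocycles2 A B\<^esub> c"

definition H2b :: "('a, 'm) monoid_scheme \<Rightarrow> ('b, 'n) monoid_scheme
    \<Rightarrow> ('a \<times> 'a \<Rightarrow> 'b) set set" where
  "H2b A B = generate (H2 A B)
     {coh_class A B c | c. c \<in> carrier (cocycles2 A B) \<and> biadditive A B (curry c)}"

definition H2_pullback ::
  "('a, 'm) monoid_scheme \<Rightarrow> ('b, 'n) monoid_scheme \<Rightarrow> ('a \<Rightarrow> 'c)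
    \<Rightarrow> ('c \<times> 'c \<Rightarrow> 'b) set \<Rightarrow> ('a \<times> 'a \<Rightarrow> 'b) set" where
  "H2_pullback A B f e =
     the_elem ((\<lambda>c. coh_class A B (\<lambda>(x, y) \<in> carrier A \<times> carrier A. c (f x, f y))) ` e)"

definition H2_pushforward ::
  "('a, 'm) monoid_scheme \<Rightarrow> ('b, 'n) monoid_scheme \<Rightarrow> ('c \<Rightarrow> 'b)
    \<Rightarrow> ('a \<times> 'a \<Rightarrow> 'c) set \<Rightarrow> ('a \<times> 'a \<Rightarrow> 'b) set" where
  "H2_pushforward A B g e =
     the_elem ((\<lambda>c. coh_class A B (\<lambda>p \<in> carrier A \<times> carrier A. g (c p))) ` e)"


section \<open>Central extensions and the map \<open>\<mu>\<close>\<close>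

locale central_extension =
  A: comm_group A + B: comm_group B + E: group E
  for A :: "('a, 'm) monoid_scheme" and B :: "('b, 'n) monoid_scheme"
    and E :: "('e, 'k) monoid_scheme" +
  fixes i :: "'b \<Rightarrow> 'e" and p :: "'e \<Rightarrow> 'a"
  assumes i_mon: "i \<in> mon B E"
    and p_epi: "p \<in> epi E A"
    and exact: "i ` carrier B = kernel E A p"
    and central: "\<lbrakk>b \<in> carrier B; x \<in> carrier E\<rbrakk> \<Longrightarrow> i b \<otimes>\<^bsub>E\<^esub> x = x \<otimes>\<^bsub>E\<^esub> i b"

text \<open>The class of an extension is that of the factor set of any set-theoretic section.\<close>

definition has_extension_class ::
  "('a, 'm) monoid_scheme \<Rightarrow> ('b, 'n) monoid_scheme \<Rightarrow> ('e, 'k) monoid_scheme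
    \<Rightarrow> ('b \<Rightarrow> 'e) \<Rightarrow> ('e \<Rightarrow> 'a) \<Rightarrow> ('a \<times> 'a \<Rightarrow> 'b) set \<Rightarrow> bool" where
  "has_extension_class A B E i p e \<longleftrightarrow> (\<exists>s c.
     s \<in> carrier A \<rightarrow> carrier E \<and> (\<forall>x \<in> carrier A. p (s x) = x) \<and>
     c \<in> carrier A \<times> carrier A \<rightarrow>\<^sub>E carrier B \<and>
     (\<forall>x \<in> carrier A. \<forall>y \<in> carrier A. s x \<otimes>\<^bsub>E\<^esub> s y = i (c (x, y)) \<otimes>\<^bsub>E\<^esub> s (x \<otimes>\<^bsub>A\<^esub> y)) \<and>
     e = coh_class A B c)"

text \<open>A central extension of \<open>A\<close> by \<open>B\<close> is in bijection with \<open>B \<times> A\<close>, so up to equivalence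
  all of them, in particular one of each class, have their carrier in the type \<open>'b \<times> 'a\<close>.\<close>

definition mu :: "('a, 'm) monoid_scheme \<Rightarrow> ('b, 'n) monoid_scheme \<Rightarrow> ('a \<times> 'a \<Rightarrow> 'b) set
    \<Rightarrow> ('a \<times> 'a \<Rightarrow>\<^sub>0 int) set set \<Rightarrow> 'b" where
  "mu A B e = (THE h.
     h \<in> hom (exterior_square A) B \<inter> extensional (carrier (exterior_square A)) \<and>
     (\<forall>(E :: ('b \<times> 'a) monoid) i p.
        central_extension A B E i p \<and> has_extension_class A B E i p e \<longrightarrow>
        (\<forall>x \<in> carrier E. \<forall>y \<in> carrier E. i (h (wedge A (p x) (p y))) = group_commutator E x y)))"


section \<open>The categories \<open>Niqab\<close>, \<open>Splab\<close> and \<open>Spl\<close>\<close>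

definition Niqab :: "('a monoid \<times> 'b monoid \<times> ('a \<times> 'a \<Rightarrow> 'b) set,
    ('a \<Rightarrow> 'a) \<times> ('b \<Rightarrow> 'b)) cat" where
  "Niqab = \<lparr>
     obj = {(A, B, e). comm_group A \<and> comm_group B \<and> e \<in> carrier (H2 A B) \<and>
       mu A B e \<in> epi (exterior_square A) B},
     mor = (\<lambda>(A, B, e) (A', B', e'). {(f, g). f \<in> mor Ab A A' \<and> g \<in> mor Ab B B' \<and>
       H2_pullback A B' f e' \<otimes>\<^bsub>H2 A B'\<^esub> inv\<^bsub>H2 A B'\<^esub> H2_pushforward A B' g e \<in> H2b A B'}),
     ident = (\<lambda>(A, B, e). (ident Ab A, ident Ab B)),
     cmp = (\<lambda>(A, B, e) (A', B', e') (A'', B'', e'') (f', g') (f, g).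
       (cmp Ab A A' A'' f' f, cmp Ab B B' B'' g' g))\<rparr>"

definition Splab :: "('a monoid \<times> 'b monoid \<times> ('a \<times> 'a \<Rightarrow> 'b) set,
    ('a \<Rightarrow> 'a) \<times> ('b \<Rightarrow> 'b)) cat" where
  "Splab = full_subcat Niqab {(A, B, e). e \<in> H2b A B}"

definition Spl :: "('a monoid \<times> 'b monoid, ('a \<Rightarrow> 'a) \<times> ('b \<Rightarrow> 'b)) cat" where
  "Spl = full_subcat (prod_cat Ab Ab) {(A, B). \<exists>f \<in> hom (tensor_square A) B.
     antisymmetrization A B f \<in> epi (exterior_square A) B}"

end

theory Submission
  imports Defs
begin

text \<open>If \<open>c\<close> is a factor set of a central extension of \<open>A\<close> by \<open>B\<close>, then the commutator pairing is
  \<open>c(x,y) - c(y,x)\<close>, and this depends only on the class of \<open>c\<close> because coboundaries are symmetric.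
  Elements of \<open>H\<^sup>2\<^sub>b\<close> are classes of bilinear cocycles, i.e. of homomorphisms \<open>A \<otimes> A \<rightarrow> B\<close>, so \<open>(A,B)\<close>
  lies in \<open>Spl\<close> iff some \<open>e\<close> makes \<open>(A,B,e)\<close> an object of \<open>Splab\<close>. Since \<open>H\<^sup>2\<^sub>b\<close> is stable under
  pullback and pushforward, the condition on morphisms of \<open>Splab\<close> is void, and forgetting \<open>e\<close> is an
  equivalence.

  A q-map is a homomorphism modulo commutators and on the commutator subgroup, hence isomorphic
  objects of \<open>Niq\<close> are similar. Conversely, a quadratic section \<open>s\<close> writes every element of \<open>G\<close>
  uniquely as \<open>s(x) + d\<close> with \<open>d \<in> [G,G]\<close>; given isomorphisms \<open>\<phi>\<close>, \<open>\<psi>\<close> of abelianizations and of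
  commutator subgroups and a quadratic section \<open>t\<close> of \<open>H\<close>, the map \<open>s(x) + d \<mapsto> t(\<phi>(x)) + \<psi>(d)\<close> has
  cross effect \<open>(\<phi>(x) | \<phi>(y))\<^sub>t - \<psi>((x | y)\<^sub>s)\<close>, which is bilinear with values in \<open>[H,H]\<close>.\<close>

section \<open>The tensor square\<close>

lemma (in comm_group) generate_normal:
  assumes "S \<subseteq> carrier G"
  shows "generate G S \<lhd> G"
  using generate_is_subgroup[OF assms] by (simp add: normal_iff_subgroup)

text \<open>A homomorphism that kills \<open>S\<close> has the generated subgroup in its kernel.
  Commutativity of \<open>G\<close> makes that subgroup normal, so the homomorphism factors through
  the quotient.\<close>

lemma Mod_generate_universal:
  assumes G: "comm_group G" and S: "S \<subseteq> carrier G" and H: "group H" and h: "h \<in> hom G H"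
    and one: "\<And>s. s \<in> S \<Longrightarrow> h s = \<one>\<^bsub>H\<^esub>"
  obtains g where "g \<in> hom (G Mod generate G S) H"
    "\<And>x. x \<in> carrier G \<Longrightarrow> g (generate G S #>\<^bsub>G\<^esub> x) = h x"
proof -
  interpret G: comm_group G by fact
  interpret h: group_hom G H h
    using H h by (simp add: group_hom_def group_hom_axioms_def)
  have "generate G S \<subseteq> kernel G H h"
    using one S by (intro G.generate_subgroup_incl h.subgroup_kernel) (auto simp: kernel_def)
  with G.generate_normal[OF S] that show thesis
    by (metis h.FactGroup_universal_kernel)
qed

context comm_group
begin

lemma tensor_relations_carrier:
  "tensor_relations G \<subseteq> carrier (free_Abelian_group (carrier G \<times> carrier G))"
proof -
  \<comment> \<open>Both families of relations have this shape, and the support of a difference lies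
    in the union of the supports.\<close>
  have "frag_of p - frag_of q - frag_of r \<in> carrier (free_Abelian_group (carrier G \<times> carrier G))"
    if "p \<in> carrier G \<times> carrier G" "q \<in> carrier G \<times> carrier G" "r \<in> carrier G \<times> carrier G" for p q r
    using that keys_diff[of "frag_of p - frag_of q" "frag_of r"] keys_diff[of "frag_of p" "frag_of q"]
    by auto
  then show ?thesis
    unfolding tensor_relations_def by auto
qed

lemma tensor_kernel_normal: "tensor_kernel G \<lhd> free_Abelian_group (carrier G \<times> carrier G)"
  unfolding tensor_kernel_def
  by (rule comm_group.generate_normal[OF abelian_free_Abelian_group tensor_relations_carrier])

lemma tensor_closed: "\<lbrakk>x \<in> carrier G; y \<in> carrier G\<rbrakk> \<Longrightarrow> tensor G x y \<in> carrier (tensor_square G)"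
  unfolding tensor_def tensor_square_def by (auto simp: carrier_FactGroup)

text \<open>A map of pairs extends to the free abelian group, and biadditivity says exactly that the
  extension kills the tensor relations. This turns a bilinear cocycle into a homomorphism on the
  tensor square.\<close>

lemma tensor_square_universal:
  assumes B: "comm_group B" and c: "biadditive G B c"
    and cl: "\<And>x y. \<lbrakk>x \<in> carrier G; y \<in> carrier G\<rbrakk> \<Longrightarrow> c x y \<in> carrier B"
  obtains f where "f \<in> hom (tensor_square G) B"
    "\<And>x y. \<lbrakk>x \<in> carrier G; y \<in> carrier G\<rbrakk> \<Longrightarrow> f (tensor G x y) = c x y"
proof -
  interpret B: comm_group B by fact
  let ?F = "free_Abelian_group (carrier G \<times> carrier G)"
  obtain h where h: "h \<in> hom ?F B"
    and h_of: "\<And>p. p \<in> carrier G \<times> carrier G \<Longrightarrow> h (frag_of p) = case_prod c p"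
    by (rule B.free_Abelian_group_universal[of "case_prod c" "carrier G \<times> carrier G"]) (auto simp: cl)
  interpret h: group_hom ?F B h
    using h B.is_group by (simp add: group_hom_def group_hom_axioms_def)
  \<comment> \<open>Covers both families of relations at once: \<open>eq\<close> is the instance of
    additivity in the first or in the second argument.\<close>
  have diff: "h (frag_of p - frag_of q - frag_of r) = \<one>\<^bsub>B\<^esub>"
    if pqr: "p \<in> carrier G \<times> carrier G" "q \<in> carrier G \<times> carrier G" "r \<in> carrier G \<times> carrier G"
      and eq: "case_prod c p = case_prod c q \<otimes>\<^bsub>B\<^esub> case_prod c r" for p q r
  proof -
    have "Poly_Mapping.keys (frag_of p - frag_of q) \<subseteq> carrier G \<times> carrier G"
      using keys_diff[of "frag_of p" "frag_of q"] pqr by auto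
    then have "h (frag_of p - frag_of q - frag_of r)
      = h (frag_of p) \<otimes>\<^bsub>B\<^esub> inv\<^bsub>B\<^esub> h (frag_of q) \<otimes>\<^bsub>B\<^esub> inv\<^bsub>B\<^esub> h (frag_of r)"
      using pqr h.hom_mult[of "frag_of p - frag_of q" "- frag_of r"]
        h.hom_mult[of "frag_of p" "- frag_of q"] h.hom_inv[of "frag_of q"] h.hom_inv[of "frag_of r"]
      by simp
    moreover have "case_prod c q \<in> carrier B" "case_prod c r \<in> carrier B"
      using pqr cl by auto
    ultimately show ?thesis
      using pqr by (simp add: h_of eq B.m_comm[of "case_prod c q"] B.m_assoc)
  qed
  have "h u = \<one>\<^bsub>B\<^esub>" if u: "u \<in> tensor_relations G" for u
    using u c unfolding tensor_relations_def
    by (auto simp: biadditive_def intro!: diff)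
  from Mod_generate_universal[OF abelian_free_Abelian_group tensor_relations_carrier B.is_group h this]
  obtain f where "f \<in> hom (tensor_square G) B"
    "\<And>u. u \<in> carrier ?F \<Longrightarrow> f (tensor_kernel G #>\<^bsub>?F\<^esub> u) = h u"
    unfolding tensor_square_def tensor_kernel_def by blast
  with that show thesis
    unfolding tensor_def using h_of by simp
qed


end


section \<open>Bilinear cocycles\<close>

locale abelian_group_pair =
  A: comm_group A + B: comm_group B
  for A :: "('a, 'm) monoid_scheme" and B :: "('b, 'n) monoid_scheme"
begin

definition bilinear_cocycles :: "('a \<times> 'a \<Rightarrow> 'b) set" where
  "bilinear_cocycles = {c \<in> carrier A \<times> carrier A \<rightarrow>\<^sub>E carrier B. biadditive A B (curry c)}"

lemma bilinear_cocyclesD: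
  assumes "c \<in> bilinear_cocycles"
  shows "\<And>x y. \<lbrakk>x \<in> carrier A; y \<in> carrier A\<rbrakk> \<Longrightarrow> c (x, y) \<in> carrier B"
    and "c \<in> extensional (carrier A \<times> carrier A)"
    and "\<And>x y z. \<lbrakk>x \<in> carrier A; y \<in> carrier A; z \<in> carrier A\<rbrakk>
      \<Longrightarrow> c (x \<otimes>\<^bsub>A\<^esub> y, z) = c (x, z) \<otimes>\<^bsub>B\<^esub> c (y, z)"
    and "\<And>x y z. \<lbrakk>x \<in> carrier A; y \<in> carrier A; z \<in> carrier A\<rbrakk>
      \<Longrightarrow> c (x, y \<otimes>\<^bsub>A\<^esub> z) = c (x, y) \<otimes>\<^bsub>B\<^esub> c (x, z)"
  using assms by (auto simp: bilinear_cocycles_def biadditive_def PiE_iff)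

text \<open>Since the unit is its own square, the value at a unit is idempotent, hence
  trivial.\<close>

lemma bilinear_cocycle_one:
  assumes c: "c \<in> bilinear_cocycles" and x: "x \<in> carrier A"
  shows "c (\<one>\<^bsub>A\<^esub>, x) = \<one>\<^bsub>B\<^esub>" "c (x, \<one>\<^bsub>A\<^esub>) = \<one>\<^bsub>B\<^esub>"
proof -
  have "c (\<one>\<^bsub>A\<^esub>, x) \<otimes>\<^bsub>B\<^esub> c (\<one>\<^bsub>A\<^esub>, x) = c (\<one>\<^bsub>A\<^esub>, x)" "c (x, \<one>\<^bsub>A\<^esub>) \<otimes>\<^bsub>B\<^esub> c (x, \<one>\<^bsub>A\<^esub>) = c (x, \<one>\<^bsub>A\<^esub>)"
    using bilinear_cocyclesD(3)[OF c, of "\<one>\<^bsub>A\<^esub>" "\<one>\<^bsub>A\<^esub>" x] bilinear_cocyclesD(4)[OF c, of x "\<one>\<^bsub>A\<^esub>" "\<one>\<^bsub>A\<^esub>"] x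
    by auto
  then show "c (\<one>\<^bsub>A\<^esub>, x) = \<one>\<^bsub>B\<^esub>" "c (x, \<one>\<^bsub>A\<^esub>) = \<one>\<^bsub>B\<^esub>"
    using bilinear_cocyclesD(1)[OF c] x by (auto intro: B.l_cancel_one[THEN iffD1])
qed

section \<open>The group of cocycles and its subgroup of bilinear maps\<close>

lemma cocycles2_comm_group: "comm_group (cocycles2 A B)"
proof (rule comm_groupI)
  let ?Z = "cocycles2 A B"
  have arg: "c (x, y) \<in> carrier B" if "c \<in> carrier ?Z" "x \<in> carrier A" "y \<in> carrier A" for c x y
    using that by (auto simp: cocycles2_def PiE_iff)
  have eq: "c (y, z) \<otimes>\<^bsub>B\<^esub> c (x, y \<otimes>\<^bsub>A\<^esub> z) = c (x \<otimes>\<^bsub>A\<^esub> y, z) \<otimes>\<^bsub>B\<^esub> c (x, y)"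
    if "c \<in> carrier ?Z" "x \<in> carrier A" "y \<in> carrier A" "z \<in> carrier A" for c x y z
    using that by (simp add: cocycles2_def)
  have ext: "c \<in> extensional (carrier A \<times> carrier A)" if "c \<in> carrier ?Z" for c
    using that by (auto simp: cocycles2_def PiE_iff)
  have Z_I: "(\<lambda>p \<in> carrier A \<times> carrier A. c p) \<in> carrier ?Z"
    if "\<And>x y. \<lbrakk>x \<in> carrier A; y \<in> carrier A\<rbrakk> \<Longrightarrow> c (x, y) \<in> carrier B"
      "\<And>x y z. \<lbrakk>x \<in> carrier A; y \<in> carrier A; z \<in> carrier A\<rbrakk>
        \<Longrightarrow> c (y, z) \<otimes>\<^bsub>B\<^esub> c (x, y \<otimes>\<^bsub>A\<^esub> z) = c (x \<otimes>\<^bsub>A\<^esub> y, z) \<otimes>\<^bsub>B\<^esub> c (x, y)" for c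
    using that by (auto simp: cocycles2_def)
  have mult: "c \<otimes>\<^bsub>?Z\<^esub> d = (\<lambda>p \<in> carrier A \<times> carrier A. c p \<otimes>\<^bsub>B\<^esub> d p)" for c d
    by (simp add: cocycles2_def)
  have one: "\<one>\<^bsub>?Z\<^esub> = (\<lambda>p \<in> carrier A \<times> carrier A. \<one>\<^bsub>B\<^esub>)"
    by (simp add: cocycles2_def)
  show "c \<otimes>\<^bsub>?Z\<^esub> d \<in> carrier ?Z" if cd: "c \<in> carrier ?Z" "d \<in> carrier ?Z" for c d
    unfolding mult
  proof (rule Z_I)
    fix x y z assume xyz: "x \<in> carrier A" "y \<in> carrier A" "z \<in> carrier A"
    have "(c (y, z) \<otimes>\<^bsub>B\<^esub> d (y, z)) \<otimes>\<^bsub>B\<^esub> (c (x, y \<otimes>\<^bsub>A\<^esub> z) \<otimes>\<^bsub>B\<^esub> d (x, y \<otimes>\<^bsub>A\<^esub> z))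
      = (c (y, z) \<otimes>\<^bsub>B\<^esub> c (x, y \<otimes>\<^bsub>A\<^esub> z)) \<otimes>\<^bsub>B\<^esub> (d (y, z) \<otimes>\<^bsub>B\<^esub> d (x, y \<otimes>\<^bsub>A\<^esub> z))"
      using xyz arg[OF cd(1)] arg[OF cd(2)] by (simp add: B.m_ac)
    also have "\<dots> = (c (x \<otimes>\<^bsub>A\<^esub> y, z) \<otimes>\<^bsub>B\<^esub> c (x, y)) \<otimes>\<^bsub>B\<^esub> (d (x \<otimes>\<^bsub>A\<^esub> y, z) \<otimes>\<^bsub>B\<^esub> d (x, y))"
      using eq[OF cd(1) xyz] eq[OF cd(2) xyz] by simp
    also have "\<dots> = (c (x \<otimes>\<^bsub>A\<^esub> y, z) \<otimes>\<^bsub>B\<^esub> d (x \<otimes>\<^bsub>A\<^esub> y, z)) \<otimes>\<^bsub>B\<^esub> (c (x, y) \<otimes>\<^bsub>B\<^esub> d (x, y))"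
      using xyz arg[OF cd(1)] arg[OF cd(2)] by (simp add: B.m_ac)
    finally show "(c (y, z) \<otimes>\<^bsub>B\<^esub> d (y, z)) \<otimes>\<^bsub>B\<^esub> (c (x, y \<otimes>\<^bsub>A\<^esub> z) \<otimes>\<^bsub>B\<^esub> d (x, y \<otimes>\<^bsub>A\<^esub> z))
      = (c (x \<otimes>\<^bsub>A\<^esub> y, z) \<otimes>\<^bsub>B\<^esub> d (x \<otimes>\<^bsub>A\<^esub> y, z)) \<otimes>\<^bsub>B\<^esub> (c (x, y) \<otimes>\<^bsub>B\<^esub> d (x, y))" .
  qed (use cd arg in auto)
  show "\<one>\<^bsub>?Z\<^esub> \<in> carrier ?Z"
    unfolding one by (rule Z_I) auto
  show "c \<otimes>\<^bsub>?Z\<^esub> d \<otimes>\<^bsub>?Z\<^esub> e = c \<otimes>\<^bsub>?Z\<^esub> (d \<otimes>\<^bsub>?Z\<^esub> e)"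
    if "c \<in> carrier ?Z" "d \<in> carrier ?Z" "e \<in> carrier ?Z" for c d e
    using that arg unfolding mult by (intro restrict_ext) (auto simp: B.m_assoc)
  show "c \<otimes>\<^bsub>?Z\<^esub> d = d \<otimes>\<^bsub>?Z\<^esub> c" if "c \<in> carrier ?Z" "d \<in> carrier ?Z" for c d
    using that arg unfolding mult by (intro restrict_ext) (auto simp: B.m_comm)
  show "\<one>\<^bsub>?Z\<^esub> \<otimes>\<^bsub>?Z\<^esub> c = c" if "c \<in> carrier ?Z" for c
    unfolding mult one using that arg ext by (intro extensionalityI[of _ "carrier A \<times> carrier A"]) auto
  show "\<exists>d \<in> carrier ?Z. d \<otimes>\<^bsub>?Z\<^esub> c = \<one>\<^bsub>?Z\<^esub>" if c: "c \<in> carrier ?Z" for c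
  proof
    show "(\<lambda>p \<in> carrier A \<times> carrier A. inv\<^bsub>B\<^esub> c p) \<in> carrier ?Z"
    proof (rule Z_I)
      fix x y z assume xyz: "x \<in> carrier A" "y \<in> carrier A" "z \<in> carrier A"
      show "inv\<^bsub>B\<^esub> c (y, z) \<otimes>\<^bsub>B\<^esub> inv\<^bsub>B\<^esub> c (x, y \<otimes>\<^bsub>A\<^esub> z) = inv\<^bsub>B\<^esub> c (x \<otimes>\<^bsub>A\<^esub> y, z) \<otimes>\<^bsub>B\<^esub> inv\<^bsub>B\<^esub> c (x, y)"
        using arg_cong[OF eq[OF c xyz], of "m_inv B"] xyz arg[OF c] by (simp add: B.inv_mult)
    qed (use c arg in auto)
    show "(\<lambda>p \<in> carrier A \<times> carrier A. inv\<^bsub>B\<^esub> c p) \<otimes>\<^bsub>?Z\<^esub> c = \<one>\<^bsub>?Z\<^esub>"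
      using c arg unfolding mult one by (intro restrict_ext) auto
  qed
qed

sublocale Z: comm_group "cocycles2 A B"
  by (rule cocycles2_comm_group)

text \<open>Biadditivity expands both sides of the cocycle identity to the sum of
  \<open>c (x, y)\<close>, \<open>c (x, z)\<close> and \<open>c (y, z)\<close>.\<close>

lemma bilinear_cocycles_subset: "bilinear_cocycles \<subseteq> carrier (cocycles2 A B)"
proof
  fix c assume c: "c \<in> bilinear_cocycles"
  then show "c \<in> carrier (cocycles2 A B)"
    using bilinear_cocyclesD(1)[OF c]
    by (auto simp: cocycles2_def bilinear_cocyclesD(3,4)[OF c] B.m_ac)
      (auto simp: bilinear_cocycles_def)
qed

lemma cocycles2_mult:
  "c \<otimes>\<^bsub>cocycles2 A B\<^esub> d = (\<lambda>p \<in> carrier A \<times> carrier A. c p \<otimes>\<^bsub>B\<^esub> d p)"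
  by (simp add: cocycles2_def)

lemma cocycles2_one: "\<one>\<^bsub>cocycles2 A B\<^esub> = (\<lambda>p \<in> carrier A \<times> carrier A. \<one>\<^bsub>B\<^esub>)"
  by (simp add: cocycles2_def)

lemma cocycles2_inv:
  assumes c: "c \<in> carrier (cocycles2 A B)"
  shows "inv\<^bsub>cocycles2 A B\<^esub> c = (\<lambda>p \<in> carrier A \<times> carrier A. inv\<^bsub>B\<^esub> c p)"
proof (rule extensionalityI[of _ "carrier A \<times> carrier A"])
  let ?d = "inv\<^bsub>cocycles2 A B\<^esub> c"
  have d: "?d \<in> carrier (cocycles2 A B)" using c by simp
  then show "?d \<in> extensional (carrier A \<times> carrier A)" by (auto simp: cocycles2_def PiE_iff)
  show "?d p = (\<lambda>p \<in> carrier A \<times> carrier A. inv\<^bsub>B\<^esub> c p) p" if p: "p \<in> carrier A \<times> carrier A" for p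
  proof -
    have "?d p \<otimes>\<^bsub>B\<^esub> c p = \<one>\<^bsub>B\<^esub>"
      using fun_cong[OF Z.l_inv[OF c], of p] p by (simp only: cocycles2_mult cocycles2_one) simp
    moreover have "?d p \<in> carrier B" "c p \<in> carrier B"
      using c d p by (auto simp: cocycles2_def PiE_iff)
    ultimately show ?thesis using p by (simp add: B.inv_equality)
  qed
qed simp

lemma bilinear_cocycles_subgroup: "subgroup bilinear_cocycles (cocycles2 A B)"
proof (rule Z.subgroupI)
  show "bilinear_cocycles \<subseteq> carrier (cocycles2 A B)" by (rule bilinear_cocycles_subset)
  have "(\<lambda>p \<in> carrier A \<times> carrier A. \<one>\<^bsub>B\<^esub>) \<in> bilinear_cocycles"
    by (auto simp: bilinear_cocycles_def biadditive_def)
  then show "bilinear_cocycles \<noteq> {}" by blast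
  fix c assume c: "c \<in> bilinear_cocycles"
  then have "c \<in> carrier (cocycles2 A B)" using bilinear_cocycles_subset by blast
  then show "inv\<^bsub>cocycles2 A B\<^esub> c \<in> bilinear_cocycles"
    using bilinear_cocyclesD(1,3,4)[OF c]
    by (auto simp: cocycles2_inv bilinear_cocycles_def biadditive_def B.inv_mult)
  fix d assume d: "d \<in> bilinear_cocycles"
  show "c \<otimes>\<^bsub>cocycles2 A B\<^esub> d \<in> bilinear_cocycles"
    using bilinear_cocyclesD(1,3,4)[OF c] bilinear_cocyclesD(1,3,4)[OF d]
    by (auto simp: cocycles2_mult bilinear_cocycles_def biadditive_def B.m_ac)
qed

section \<open>Coboundaries and cohomology classes\<close>

definition coboundary :: "('a \<Rightarrow> 'b) \<Rightarrow> 'a \<times> 'a \<Rightarrow> 'b" where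
  "coboundary h = (\<lambda>(x, y) \<in> carrier A \<times> carrier A. h x \<otimes>\<^bsub>B\<^esub> h y \<otimes>\<^bsub>B\<^esub> inv\<^bsub>B\<^esub> h (x \<otimes>\<^bsub>A\<^esub> y))"

lemma coboundaries2_eq: "coboundaries2 A B = coboundary ` (carrier A \<rightarrow> carrier B)"
  by (auto simp: coboundaries2_def coboundary_def)

text \<open>Commutativity of \<open>A\<close> and of \<open>B\<close> gives the symmetry. It makes
  the antisymmetrization of a cocycle an invariant of its class.\<close>

lemma coboundary_symmetric:
  assumes "h \<in> carrier A \<rightarrow> carrier B" "x \<in> carrier A" "y \<in> carrier A"
  shows "coboundary h (x, y) = coboundary h (y, x)" "coboundary h (x, y) \<in> carrier B"
  using assms by (auto simp: coboundary_def Pi_iff A.m_comm[of x y] B.m_comm[of "h x" "h y"])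

lemma coboundary_cocycle:
  assumes h: "h \<in> carrier A \<rightarrow> carrier B"
  shows "coboundary h \<in> carrier (cocycles2 A B)"
proof -
  have "h y \<otimes>\<^bsub>B\<^esub> h z \<otimes>\<^bsub>B\<^esub> inv\<^bsub>B\<^esub> h (y \<otimes>\<^bsub>A\<^esub> z) \<otimes>\<^bsub>B\<^esub> (h x \<otimes>\<^bsub>B\<^esub> h (y \<otimes>\<^bsub>A\<^esub> z) \<otimes>\<^bsub>B\<^esub> inv\<^bsub>B\<^esub> h (x \<otimes>\<^bsub>A\<^esub> (y \<otimes>\<^bsub>A\<^esub> z)))
    = h (x \<otimes>\<^bsub>A\<^esub> y) \<otimes>\<^bsub>B\<^esub> h z \<otimes>\<^bsub>B\<^esub> inv\<^bsub>B\<^esub> h (x \<otimes>\<^bsub>A\<^esub> (y \<otimes>\<^bsub>A\<^esub> z)) \<otimes>\<^bsub>B\<^esub> (h x \<otimes>\<^bsub>B\<^esub> h y \<otimes>\<^bsub>B\<^esub> inv\<^bsub>B\<^esub> h (x \<otimes>\<^bsub>A\<^esub> y))"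
    (is "?l = ?r") if xyz: "x \<in> carrier A" "y \<in> carrier A" "z \<in> carrier A" for x y z
  proof -
    have B: "h x \<in> carrier B" "h y \<in> carrier B" "h z \<in> carrier B" "h (x \<otimes>\<^bsub>A\<^esub> y) \<in> carrier B"
      "h (y \<otimes>\<^bsub>A\<^esub> z) \<in> carrier B" "h (x \<otimes>\<^bsub>A\<^esub> (y \<otimes>\<^bsub>A\<^esub> z)) \<in> carrier B"
      using h xyz by auto
    \<comment> \<open>After sorting, both sides share all factors except one cancelling pair:
      \<open>h (y \<otimes> z)\<close> with its inverse on the left,
      \<open>h (x \<otimes> y)\<close> with its inverse on the right.\<close>
    have "?l = h x \<otimes>\<^bsub>B\<^esub> h y \<otimes>\<^bsub>B\<^esub> h z \<otimes>\<^bsub>B\<^esub> inv\<^bsub>B\<^esub> h (x \<otimes>\<^bsub>A\<^esub> (y \<otimes>\<^bsub>A\<^esub> z)) \<otimes>\<^bsub>B\<^esub> (h (y \<otimes>\<^bsub>A\<^esub> z) \<otimes>\<^bsub>B\<^esub> inv\<^bsub>B\<^esub> h (y \<otimes>\<^bsub>A\<^esub> z))"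
      using B by (simp only: B.m_ac B.m_closed B.inv_closed)
    moreover have "?r = h x \<otimes>\<^bsub>B\<^esub> h y \<otimes>\<^bsub>B\<^esub> h z \<otimes>\<^bsub>B\<^esub> inv\<^bsub>B\<^esub> h (x \<otimes>\<^bsub>A\<^esub> (y \<otimes>\<^bsub>A\<^esub> z)) \<otimes>\<^bsub>B\<^esub> (h (x \<otimes>\<^bsub>A\<^esub> y) \<otimes>\<^bsub>B\<^esub> inv\<^bsub>B\<^esub> h (x \<otimes>\<^bsub>A\<^esub> y))"
      using B by (simp only: B.m_ac B.m_closed B.inv_closed)
    ultimately show ?thesis using B by simp
  qed
  then show ?thesis
    using h by (auto simp: cocycles2_def coboundary_def A.m_assoc Pi_iff)
qed

lemma coboundaries2_subgroup: "subgroup (coboundaries2 A B) (cocycles2 A B)"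
proof (rule Z.subgroupI)
  show "coboundaries2 A B \<subseteq> carrier (cocycles2 A B)"
    using coboundary_cocycle by (auto simp: coboundaries2_eq)
  show "coboundaries2 A B \<noteq> {}"
    by (auto simp: coboundaries2_eq intro!: exI[of _ "\<lambda>_. \<one>\<^bsub>B\<^esub>"])
  fix c assume "c \<in> coboundaries2 A B"
  then obtain h where h: "h \<in> carrier A \<rightarrow> carrier B" "c = coboundary h"
    by (auto simp: coboundaries2_eq)
  have "inv\<^bsub>cocycles2 A B\<^esub> c = coboundary (\<lambda>x. inv\<^bsub>B\<^esub> h x)"
    unfolding h(2) cocycles2_inv[OF coboundary_cocycle[OF h(1)]] unfolding coboundary_def
    using h(1) by (intro restrict_ext) (auto simp: B.inv_mult Pi_iff)
  then show "inv\<^bsub>cocycles2 A B\<^esub> c \<in> coboundaries2 A B"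
    using h(1) by (auto simp: coboundaries2_eq)
  fix d assume "d \<in> coboundaries2 A B"
  then obtain k where k: "k \<in> carrier A \<rightarrow> carrier B" "d = coboundary k"
    by (auto simp: coboundaries2_eq)
  have "c \<otimes>\<^bsub>cocycles2 A B\<^esub> d = coboundary (\<lambda>x. h x \<otimes>\<^bsub>B\<^esub> k x)"
    unfolding cocycles2_mult h(2) k(2) coboundary_def
    using h(1) k(1) by (intro restrict_ext) (auto simp: B.inv_mult Pi_iff B.m_ac)
  then show "c \<otimes>\<^bsub>cocycles2 A B\<^esub> d \<in> coboundaries2 A B"
    using h(1) k(1) by (auto simp: coboundaries2_eq)
qed

lemma coboundaries2_normal: "coboundaries2 A B \<lhd> cocycles2 A B"
  using coboundaries2_subgroup by (simp add: Z.normal_iff_subgroup)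

lemma coh_class_hom: "coh_class A B \<in> hom (cocycles2 A B) (H2 A B)"
  using normal.r_coset_hom_Mod[OF coboundaries2_normal]
  by (simp add: coh_class_def[abs_def] H2_def)

lemma coh_class_closed: "c \<in> carrier (cocycles2 A B) \<Longrightarrow> coh_class A B c \<in> carrier (H2 A B)"
  using coh_class_hom by (auto simp: hom_def)

lemma H2_comm_group: "comm_group (H2 A B)"
  unfolding H2_def by (rule Z.abelian_FactGroup[OF coboundaries2_subgroup])

text \<open>Bilinear cocycles form a group, so every element of \<open>H2b\<close> is the class of one of them.\<close>

lemma H2b_eq: "H2b A B = coh_class A B ` bilinear_cocycles"
proof -
  interpret H: comm_group "H2 A B" by (rule H2_comm_group)
  interpret q: group_hom "cocycles2 A B" "H2 A B" "coh_class A B"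
    using coh_class_hom Z.is_group H.is_group by (simp add: group_hom_def group_hom_axioms_def)
  have "bilinear_cocycles = {c. c \<in> carrier (cocycles2 A B) \<and> biadditive A B (curry c)}"
    using bilinear_cocycles_subset by (auto simp: bilinear_cocycles_def) (auto simp: cocycles2_def)
  then have "{coh_class A B c | c. c \<in> carrier (cocycles2 A B) \<and> biadditive A B (curry c)}
    = coh_class A B ` bilinear_cocycles"
    by (simp add: setcompr_eq_image)
  moreover have "generate (cocycles2 A B) bilinear_cocycles = bilinear_cocycles"
    by (rule Z.generateI[OF bilinear_cocycles_subgroup, symmetric]) auto
  ultimately show ?thesis
    unfolding H2b_def by (simp add: q.generate_img[OF bilinear_cocycles_subset])
qed

lemma H2b_subgroup: "subgroup (H2b A B) (H2 A B)"
proof -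
  interpret H: comm_group "H2 A B" by (rule H2_comm_group)
  show ?thesis
    unfolding H2b_def by (rule H.generate_is_subgroup) (auto intro: coh_class_closed)
qed

lemma coh_class_memD:
  assumes "d \<in> coh_class A B c"
  obtains h where "h \<in> carrier A \<rightarrow> carrier B"
    "d = (\<lambda>p \<in> carrier A \<times> carrier A. coboundary h p \<otimes>\<^bsub>B\<^esub> c p)"
  using assms that by (auto simp: coh_class_def r_coset_def coboundaries2_eq cocycles2_mult)

text \<open>Stated for arbitrary functions rather than cocycles because it is applied to the factor
  sets of extensions, which come only with their range. The trivial coboundary acts as the identity
  on every such function.\<close>

lemma coh_class_self:
  assumes "c \<in> carrier A \<times> carrier A \<rightarrow>\<^sub>E carrier B"
  shows "c \<in> coh_class A B c"
proof -
  have "\<one>\<^bsub>cocycles2 A B\<^esub> \<otimes>\<^bsub>cocycles2 A B\<^esub> c = c"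
    unfolding cocycles2_mult cocycles2_one
    using assms by (intro extensionalityI[of _ "carrier A \<times> carrier A"]) (auto simp: PiE_iff)
  then show ?thesis
    using subgroup.one_closed[OF coboundaries2_subgroup] by (force simp: coh_class_def r_coset_def)
qed

lemma coh_class_coboundary_mult:
  assumes "h \<in> carrier A \<rightarrow> carrier B" and "c \<in> carrier (cocycles2 A B)"
  shows "coh_class A B (\<lambda>p \<in> carrier A \<times> carrier A. coboundary h p \<otimes>\<^bsub>B\<^esub> c p) = coh_class A B c"
proof -
  have "coboundary h \<otimes>\<^bsub>cocycles2 A B\<^esub> c \<in> coh_class A B c"
    using assms(1) by (auto simp: coh_class_def r_coset_def coboundaries2_eq)
  then show ?thesis
    using Z.repr_independence[OF _ assms(2) coboundaries2_subgroup] by (simp add: coh_class_def cocycles2_mult)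
qed

text \<open>Pullback and pushforward are defined by picking the single element of an image of a
  class. This reduces their evaluation to checking that the value is unchanged when a coboundary is
  added to the representative.\<close>

lemma the_elem_coh_class_image:
  assumes "\<And>h. h \<in> carrier A \<rightarrow> carrier B
      \<Longrightarrow> P (\<lambda>p \<in> carrier A \<times> carrier A. coboundary h p \<otimes>\<^bsub>B\<^esub> c p) = e"
    and "c \<in> carrier A \<times> carrier A \<rightarrow>\<^sub>E carrier B"
  shows "the_elem (P ` coh_class A B c) = e"
proof -
  have "P ` coh_class A B c = {e}"
  proof (intro equalityI subsetI)
    show "y \<in> {e}" if "y \<in> P ` coh_class A B c" for y
      using that assms(1) by (auto elim!: coh_class_memD)
    \<comment> \<open>The hypothesis speaks of perturbed representatives only; \<open>c\<close> is
      one of them because it lies in its own class.\<close>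
    have "P c = e"
      using coh_class_memD[OF coh_class_self[OF assms(2)]] assms(1) by metis
    then show "y \<in> P ` coh_class A B c" if "y \<in> {e}" for y
      using that coh_class_self[OF assms(2)] by auto
  qed
  then show ?thesis by simp
qed

end

section \<open>Stability of bilinear classes under pullback and pushforward\<close>

lemma H2_pullback_H2b:
  assumes "abelian_group_pair A B" "abelian_group_pair A' B" and f: "f \<in> hom A A'" and e: "e \<in> H2b A' B"
  shows "H2_pullback A B f e \<in> H2b A B"
proof -
  interpret P: abelian_group_pair A B by fact
  interpret Q: abelian_group_pair A' B by fact
  obtain c where c: "c \<in> Q.bilinear_cocycles" "e = coh_class A' B c"
    using e by (auto simp: Q.H2b_eq)
  let ?d = "\<lambda>c. \<lambda>(x, y) \<in> carrier A \<times> carrier A. c (f x, f y)"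
  have fc: "f x \<in> carrier A'" if "x \<in> carrier A" for x
    using that f by (auto simp: hom_def)
  have fm: "f (x \<otimes>\<^bsub>A\<^esub> y) = f x \<otimes>\<^bsub>A'\<^esub> f y" if "x \<in> carrier A" "y \<in> carrier A" for x y
    using that f by (auto simp: hom_def)
  have d: "?d c \<in> P.bilinear_cocycles"
    using Q.bilinear_cocyclesD(1,3,4)[OF c(1)]
    by (auto simp: P.bilinear_cocycles_def biadditive_def fc fm)
  have "H2_pullback A B f e = coh_class A B (?d c)"
    unfolding H2_pullback_def c(2)
  proof (rule Q.the_elem_coh_class_image)
    fix h assume h: "h \<in> carrier A' \<rightarrow> carrier B"
    have hf: "h \<circ> f \<in> carrier A \<rightarrow> carrier B" using h fc by auto
    \<comment> \<open>The coboundary of \<open>h\<close> pulls back to the coboundary of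
      \<open>h \<circ> f\<close>, as \<open>f\<close> is a homomorphism; hence the class of the
      pulled back cocycle does not depend on the representative.\<close>
    have eq: "?d (\<lambda>p \<in> carrier A' \<times> carrier A'. Q.coboundary h p \<otimes>\<^bsub>B\<^esub> c p)
      = (\<lambda>p \<in> carrier A \<times> carrier A. P.coboundary (h \<circ> f) p \<otimes>\<^bsub>B\<^esub> ?d c p)"
      by (intro restrict_ext) (auto simp: P.coboundary_def Q.coboundary_def fc fm)
    show "coh_class A B (?d (\<lambda>p \<in> carrier A' \<times> carrier A'. Q.coboundary h p \<otimes>\<^bsub>B\<^esub> c p)) = coh_class A B (?d c)"
      unfolding eq by (rule P.coh_class_coboundary_mult[OF hf]) (use d P.bilinear_cocycles_subset in blast)
  qed (use c(1) in \<open>auto simp: Q.bilinear_cocycles_def\<close>)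
  then show ?thesis using d by (auto simp: P.H2b_eq)
qed

text \<open>Composition with the homomorphism \<open>g\<close> keeps a cocycle bilinear and sends
  the coboundary of \<open>h\<close> to that of \<open>g \<circ> h\<close>.\<close>

lemma H2_pushforward_H2b:
  assumes "abelian_group_pair A B" "abelian_group_pair A B'" and g: "g \<in> hom B B'" and e: "e \<in> H2b A B"
  shows "H2_pushforward A B' g e \<in> H2b A B'"
proof -
  interpret Q: abelian_group_pair A B by fact
  interpret P: abelian_group_pair A B' by fact
  interpret g: group_hom B B' g
    using g P.B.is_group Q.B.is_group by (simp add: group_hom_def group_hom_axioms_def)
  obtain c where c: "c \<in> Q.bilinear_cocycles" "e = coh_class A B c"
    using e by (auto simp: Q.H2b_eq)
  let ?d = "\<lambda>c. \<lambda>p \<in> carrier A \<times> carrier A. g (c p)"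
  have d: "?d c \<in> P.bilinear_cocycles"
    using Q.bilinear_cocyclesD(1,3,4)[OF c(1)]
    by (auto simp: P.bilinear_cocycles_def biadditive_def)
  have "H2_pushforward A B' g e = coh_class A B' (?d c)"
    unfolding H2_pushforward_def c(2)
  proof (rule Q.the_elem_coh_class_image)
    fix h assume h: "h \<in> carrier A \<rightarrow> carrier B"
    have hf: "g \<circ> h \<in> carrier A \<rightarrow> carrier B'" using h by (auto simp: Pi_iff)
    have eq: "?d (\<lambda>p \<in> carrier A \<times> carrier A. Q.coboundary h p \<otimes>\<^bsub>B\<^esub> c p)
      = (\<lambda>p \<in> carrier A \<times> carrier A. P.coboundary (g \<circ> h) p \<otimes>\<^bsub>B'\<^esub> ?d c p)"
      using h Q.bilinear_cocyclesD(1)[OF c(1)]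
      by (intro restrict_ext) (auto simp: P.coboundary_def Q.coboundary_def Pi_iff)
    show "coh_class A B' (?d (\<lambda>p \<in> carrier A \<times> carrier A. Q.coboundary h p \<otimes>\<^bsub>B\<^esub> c p)) = coh_class A B' (?d c)"
      unfolding eq by (rule P.coh_class_coboundary_mult[OF hf]) (use d P.bilinear_cocycles_subset in blast)
  qed (use c(1) in \<open>auto simp: Q.bilinear_cocycles_def\<close>)
  then show ?thesis using d by (auto simp: P.H2b_eq)
qed


section \<open>Commutators in central extensions\<close>

text \<open>Write each element as a central part times a value of the section. The products in the
  two orders then have the same section part, because \<open>A\<close> is commutative, and their
  central parts differ only in the value of the factor set.\<close>

lemma (in central_extension) group_commutator_factor_set:
  assumes s: "s \<in> carrier A \<rightarrow> carrier E" "\<And>x. x \<in> carrier A \<Longrightarrow> p (s x) = x"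
    and c: "\<And>x y. \<lbrakk>x \<in> carrier A; y \<in> carrier A\<rbrakk> \<Longrightarrow> c (x, y) \<in> carrier B"
    and fs: "\<And>x y. \<lbrakk>x \<in> carrier A; y \<in> carrier A\<rbrakk>
      \<Longrightarrow> s x \<otimes>\<^bsub>E\<^esub> s y = i (c (x, y)) \<otimes>\<^bsub>E\<^esub> s (x \<otimes>\<^bsub>A\<^esub> y)"
    and x: "x \<in> carrier E" and y: "y \<in> carrier E"
  shows "group_commutator E x y = i (c (p x, p y) \<otimes>\<^bsub>B\<^esub> inv\<^bsub>B\<^esub> c (p y, p x))"
proof -
  interpret i: group_hom B E i
    using i_mon by (simp add: mon_def group_hom_def group_hom_axioms_def B.is_group E.is_group)
  interpret p: group_hom E A p
    using p_epi by (simp add: epi_def group_hom_def group_hom_axioms_def A.is_group E.is_group)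
  \<comment> \<open>Dividing \<open>z\<close> by \<open>s (p z)\<close> gives an element of the
    kernel of \<open>p\<close>, which is the image of \<open>i\<close>.\<close>
  have decomp: "\<exists>b \<in> carrier B. z = i b \<otimes>\<^bsub>E\<^esub> s (p z)" if z: "z \<in> carrier E" for z
  proof -
    have sz: "s (p z) \<in> carrier E" using s(1) z by auto
    have "p (z \<otimes>\<^bsub>E\<^esub> inv\<^bsub>E\<^esub> s (p z)) = \<one>\<^bsub>A\<^esub>" using s(2) z sz by simp
    then have "z \<otimes>\<^bsub>E\<^esub> inv\<^bsub>E\<^esub> s (p z) \<in> kernel E A p" using z sz by (simp add: kernel_def)
    then obtain b where "b \<in> carrier B" "z \<otimes>\<^bsub>E\<^esub> inv\<^bsub>E\<^esub> s (p z) = i b" using exact by blast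
    then show ?thesis using z sz by (metis E.inv_solve_right' i.hom_closed E.m_closed)
  qed
  have prod: "z \<otimes>\<^bsub>E\<^esub> w = i (a \<otimes>\<^bsub>B\<^esub> b \<otimes>\<^bsub>B\<^esub> c (p z, p w)) \<otimes>\<^bsub>E\<^esub> s (p z \<otimes>\<^bsub>A\<^esub> p w)"
    if z: "z \<in> carrier E" "w \<in> carrier E" and ab: "a \<in> carrier B" "b \<in> carrier B"
      and zd: "z = i a \<otimes>\<^bsub>E\<^esub> s (p z)" and wd: "w = i b \<otimes>\<^bsub>E\<^esub> s (p w)" for z w a b
  proof -
    have cl: "s (p z) \<in> carrier E" "s (p w) \<in> carrier E" "s (p z \<otimes>\<^bsub>A\<^esub> p w) \<in> carrier E"
      using s(1) z by auto
    \<comment> \<open>The equations \<open>zd\<close> and \<open>wd\<close> contain \<open>z\<close>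
      and \<open>w\<close> on their right-hand sides as well, so each is applied exactly once, by
      congruence.\<close>
    have "z \<otimes>\<^bsub>E\<^esub> w = (i a \<otimes>\<^bsub>E\<^esub> s (p z)) \<otimes>\<^bsub>E\<^esub> (i b \<otimes>\<^bsub>E\<^esub> s (p w))"
      by (rule arg_cong2[OF zd wd])
    also have "\<dots> = i a \<otimes>\<^bsub>E\<^esub> (s (p z) \<otimes>\<^bsub>E\<^esub> i b) \<otimes>\<^bsub>E\<^esub> s (p w)"
      using ab cl by (simp add: E.m_assoc)
    also have "\<dots> = i a \<otimes>\<^bsub>E\<^esub> i b \<otimes>\<^bsub>E\<^esub> (s (p z) \<otimes>\<^bsub>E\<^esub> s (p w))"
      using ab cl by (simp add: central[of b "s (p z)", symmetric] E.m_assoc)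
    also have "\<dots> = i (a \<otimes>\<^bsub>B\<^esub> b \<otimes>\<^bsub>B\<^esub> c (p z, p w)) \<otimes>\<^bsub>E\<^esub> s (p z \<otimes>\<^bsub>A\<^esub> p w)"
      using ab cl c z by (simp add: fs E.m_assoc)
    finally show ?thesis .
  qed
  obtain a where a: "a \<in> carrier B" "x = i a \<otimes>\<^bsub>E\<^esub> s (p x)" using decomp[OF x] by blast
  obtain b where b: "b \<in> carrier B" "y = i b \<otimes>\<^bsub>E\<^esub> s (p y)" using decomp[OF y] by blast
  let ?k = "c (p x, p y) \<otimes>\<^bsub>B\<^esub> inv\<^bsub>B\<^esub> c (p y, p x)"
  have cl: "c (p x, p y) \<in> carrier B" "c (p y, p x) \<in> carrier B" "s (p x \<otimes>\<^bsub>A\<^esub> p y) \<in> carrier E"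
    using c s(1) x y by auto
  have "a \<otimes>\<^bsub>B\<^esub> b \<otimes>\<^bsub>B\<^esub> c (p x, p y) = ?k \<otimes>\<^bsub>B\<^esub> (b \<otimes>\<^bsub>B\<^esub> a \<otimes>\<^bsub>B\<^esub> c (p y, p x))"
  proof -
    have "?k \<otimes>\<^bsub>B\<^esub> (b \<otimes>\<^bsub>B\<^esub> a \<otimes>\<^bsub>B\<^esub> c (p y, p x))
      = a \<otimes>\<^bsub>B\<^esub> b \<otimes>\<^bsub>B\<^esub> c (p x, p y) \<otimes>\<^bsub>B\<^esub> (c (p y, p x) \<otimes>\<^bsub>B\<^esub> inv\<^bsub>B\<^esub> c (p y, p x))"
      using a(1) b(1) cl by (simp only: B.m_ac B.m_closed B.inv_closed)
    then show ?thesis using a(1) b(1) cl by simp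
  qed
  then have "x \<otimes>\<^bsub>E\<^esub> y = i ?k \<otimes>\<^bsub>E\<^esub> (y \<otimes>\<^bsub>E\<^esub> x)"
    using prod[OF x y a(1) b(1) a(2) b(2)] prod[OF y x b(1) a(1) b(2) a(2)] a(1) b(1) cl x y
    by (simp add: A.m_comm[of "p y" "p x"] E.m_assoc)
  then have "x \<otimes>\<^bsub>E\<^esub> y = y \<otimes>\<^bsub>E\<^esub> x \<otimes>\<^bsub>E\<^esub> i ?k"
    using central[of ?k "y \<otimes>\<^bsub>E\<^esub> x"] x y cl by simp
  \<comment> \<open>The commutator is the factor by which the product of \<open>x\<close> and
    \<open>y\<close> differs from that of \<open>y\<close> and \<open>x\<close>, which has just been
    found to be \<open>i ?k\<close>.\<close>
  moreover have "group_commutator E x y = inv\<^bsub>E\<^esub> (y \<otimes>\<^bsub>E\<^esub> x) \<otimes>\<^bsub>E\<^esub> (x \<otimes>\<^bsub>E\<^esub> y)"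
    using x y by (simp add: group_commutator_def E.inv_mult_group E.m_assoc)
  ultimately show ?thesis
    using x y cl by (metis B.inv_closed B.m_closed E.inv_solve_left E.m_closed i.hom_closed)
qed

context abelian_group_pair
begin

text \<open>The standard central extension with factor set \<open>c\<close>, on the carrier type
  over which \<open>mu\<close> quantifies. It is a witness that the class of \<open>c\<close> is
  realized, so that the condition in \<open>mu\<close> is not vacuous. The pair of units is neutral
  because a bilinear \<open>c\<close> is trivial when one argument is the unit.\<close>

definition bilinear_extension :: "('a \<times> 'a \<Rightarrow> 'b) \<Rightarrow> ('b \<times> 'a) monoid" where
  "bilinear_extension c = \<lparr>carrier = carrier B \<times> carrier A,
     monoid.mult = (\<lambda>(b, x) (b', x'). (b \<otimes>\<^bsub>B\<^esub> b' \<otimes>\<^bsub>B\<^esub> c (x, x'), x \<otimes>\<^bsub>A\<^esub> x')),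
     one = (\<one>\<^bsub>B\<^esub>, \<one>\<^bsub>A\<^esub>)\<rparr>"

lemma group_bilinear_extension:
  assumes c: "c \<in> bilinear_cocycles"
  shows "group (bilinear_extension c)"
proof (rule groupI)
  note cl = bilinear_cocyclesD(1)[OF c]
  let ?E = "bilinear_extension c"
  show "u \<otimes>\<^bsub>?E\<^esub> v \<in> carrier ?E" if "u \<in> carrier ?E" "v \<in> carrier ?E" for u v
    using that cl by (auto simp: bilinear_extension_def)
  show "\<one>\<^bsub>?E\<^esub> \<in> carrier ?E" by (simp add: bilinear_extension_def)
  show "u \<otimes>\<^bsub>?E\<^esub> v \<otimes>\<^bsub>?E\<^esub> w = u \<otimes>\<^bsub>?E\<^esub> (v \<otimes>\<^bsub>?E\<^esub> w)"
    if "u \<in> carrier ?E" "v \<in> carrier ?E" "w \<in> carrier ?E" for u v w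
    using that cl
    by (auto simp: bilinear_extension_def bilinear_cocyclesD(3,4)[OF c] B.m_ac A.m_assoc)
  show "\<one>\<^bsub>?E\<^esub> \<otimes>\<^bsub>?E\<^esub> u = u" if "u \<in> carrier ?E" for u
    using that bilinear_cocycle_one[OF c] by (auto simp: bilinear_extension_def)
  show "\<exists>v \<in> carrier ?E. v \<otimes>\<^bsub>?E\<^esub> u = \<one>\<^bsub>?E\<^esub>" if u: "u \<in> carrier ?E" for u
  proof -
    obtain b x where bx: "u = (b, x)" "b \<in> carrier B" "x \<in> carrier A"
      using u by (auto simp: bilinear_extension_def)
    \<comment> \<open>The first coordinate of the left inverse must also cancel the contribution
      \<open>c (inv x, x)\<close> of the multiplication.\<close>
    have "(inv\<^bsub>B\<^esub> (b \<otimes>\<^bsub>B\<^esub> c (inv\<^bsub>A\<^esub> x, x)), inv\<^bsub>A\<^esub> x) \<otimes>\<^bsub>?E\<^esub> u = \<one>\<^bsub>?E\<^esub>"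
      using bx cl by (simp add: bilinear_extension_def B.m_assoc)
    moreover have "(inv\<^bsub>B\<^esub> (b \<otimes>\<^bsub>B\<^esub> c (inv\<^bsub>A\<^esub> x, x)), inv\<^bsub>A\<^esub> x) \<in> carrier ?E"
      using bx cl by (simp add: bilinear_extension_def)
    ultimately show ?thesis by blast
  qed
qed

lemma central_extension_bilinear_extension:
  assumes c: "c \<in> bilinear_cocycles"
  shows "central_extension A B (bilinear_extension c) (\<lambda>b. (b, \<one>\<^bsub>A\<^esub>)) snd"
    and "has_extension_class A B (bilinear_extension c) (\<lambda>b. (b, \<one>\<^bsub>A\<^esub>)) snd (coh_class A B c)"
proof -
  let ?E = "bilinear_extension c"
  interpret E: group ?E by (rule group_bilinear_extension[OF c])
  note cl = bilinear_cocyclesD(1)[OF c] and one = bilinear_cocycle_one[OF c]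
  show "central_extension A B ?E (\<lambda>b. (b, \<one>\<^bsub>A\<^esub>)) snd"
  proof unfold_locales
    show "(\<lambda>b. (b, \<one>\<^bsub>A\<^esub>)) \<in> mon B ?E"
      using one by (auto simp: mon_def hom_def bilinear_extension_def inj_on_def)
    show "snd \<in> epi ?E A"
      by (force simp: epi_def hom_def bilinear_extension_def image_iff)
    show "(\<lambda>b. (b, \<one>\<^bsub>A\<^esub>)) ` carrier B = kernel ?E A snd"
      by (auto simp: kernel_def bilinear_extension_def)
    show "(b, \<one>\<^bsub>A\<^esub>) \<otimes>\<^bsub>?E\<^esub> x = x \<otimes>\<^bsub>?E\<^esub> (b, \<one>\<^bsub>A\<^esub>)" if "b \<in> carrier B" "x \<in> carrier ?E" for b x
      using that one by (auto simp: bilinear_extension_def B.m_comm)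
  qed
  show "has_extension_class A B ?E (\<lambda>b. (b, \<one>\<^bsub>A\<^esub>)) snd (coh_class A B c)"
    unfolding has_extension_class_def
    \<comment> \<open>The evident section has factor set exactly \<open>c\<close>.\<close>
    by (rule exI[of _ "\<lambda>x. (\<one>\<^bsub>B\<^esub>, x)"], rule exI[of _ c])
      (use c cl one in \<open>auto simp: bilinear_extension_def bilinear_cocycles_def\<close>)
qed

section \<open>Comparison of \<open>mu\<close> with the antisymmetrization of bilinear maps\<close>

lemma antisymmetrized_coboundary_mult:
  assumes h: "h \<in> carrier A \<rightarrow> carrier B"
    and c: "\<And>x y. \<lbrakk>x \<in> carrier A; y \<in> carrier A\<rbrakk> \<Longrightarrow> c (x, y) \<in> carrier B"
    and xy: "x \<in> carrier A" "y \<in> carrier A"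
  shows "(coboundary h (x, y) \<otimes>\<^bsub>B\<^esub> c (x, y)) \<otimes>\<^bsub>B\<^esub> inv\<^bsub>B\<^esub> (coboundary h (y, x) \<otimes>\<^bsub>B\<^esub> c (y, x))
    = c (x, y) \<otimes>\<^bsub>B\<^esub> inv\<^bsub>B\<^esub> c (y, x)"
proof -
  have "k \<otimes>\<^bsub>B\<^esub> a \<otimes>\<^bsub>B\<^esub> inv\<^bsub>B\<^esub> (k \<otimes>\<^bsub>B\<^esub> b) = a \<otimes>\<^bsub>B\<^esub> inv\<^bsub>B\<^esub> b"
    if "k \<in> carrier B" "a \<in> carrier B" "b \<in> carrier B" for k a b
    using that by (simp add: B.inv_mult B.m_comm[of k a] B.m_assoc) (simp add: B.m_assoc[symmetric])
  then show ?thesis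
    using coboundary_symmetric[OF h xy(2,1)] xy c by simp
qed

text \<open>The right-hand side is literally the description defining \<open>antisymmetrization\<close>, so the two
  can be identified without knowing that the described homomorphism exists.\<close>

lemma mu_coh_class:
  assumes c: "c \<in> bilinear_cocycles"
  shows "mu A B (coh_class A B c) = (THE h.
     h \<in> hom (exterior_square A) B \<inter> extensional (carrier (exterior_square A)) \<and>
     (\<forall>x \<in> carrier A. \<forall>y \<in> carrier A. h (wedge A x y) = c (x, y) \<otimes>\<^bsub>B\<^esub> inv\<^bsub>B\<^esub> c (y, x)))"
proof -
  let ?d = "\<lambda>x y. c (x, y) \<otimes>\<^bsub>B\<^esub> inv\<^bsub>B\<^esub> c (y, x)"
  let ?E = "bilinear_extension c"
  \<comment> \<open>A factor set of any extension in the class differs from \<open>c\<close> by a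
    coboundary, which cancels on antisymmetrizing; all these extensions therefore have the same
    commutator pairing.\<close>
  have commutator: "group_commutator E x y = i (?d (p x) (p y))"
    if "central_extension A B E i p" and cls: "has_extension_class A B E i p (coh_class A B c)"
      and xy: "x \<in> carrier E" "y \<in> carrier E" for E :: "('b \<times> 'a) monoid" and i p x y
  proof -
    interpret E: central_extension A B E i p by fact
    have p: "p x \<in> carrier A" "p y \<in> carrier A"
      using xy E.p_epi by (auto simp: epi_def hom_def)
    obtain s c' where s: "s \<in> carrier A \<rightarrow> carrier E" "\<And>x. x \<in> carrier A \<Longrightarrow> p (s x) = x"
      and c': "c' \<in> carrier A \<times> carrier A \<rightarrow>\<^sub>E carrier B" "coh_class A B c = coh_class A B c'"
      and fs: "\<And>x y. \<lbrakk>x \<in> carrier A; y \<in> carrier A\<rbrakk>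
        \<Longrightarrow> s x \<otimes>\<^bsub>E\<^esub> s y = i (c' (x, y)) \<otimes>\<^bsub>E\<^esub> s (x \<otimes>\<^bsub>A\<^esub> y)"
      using cls unfolding has_extension_class_def by blast
    have "c' \<in> coh_class A B c" using coh_class_self[OF c'(1)] c'(2) by simp
    then obtain h where h: "h \<in> carrier A \<rightarrow> carrier B"
      "c' = (\<lambda>p \<in> carrier A \<times> carrier A. coboundary h p \<otimes>\<^bsub>B\<^esub> c p)"
      by (rule coh_class_memD)
    have "group_commutator E x y = i (c' (p x, p y) \<otimes>\<^bsub>B\<^esub> inv\<^bsub>B\<^esub> c' (p y, p x))"
      by (rule E.group_commutator_factor_set[OF s _ fs xy]) (use c'(1) in auto)
    also have "c' (p x, p y) \<otimes>\<^bsub>B\<^esub> inv\<^bsub>B\<^esub> c' (p y, p x) = ?d (p x) (p y)"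
      using antisymmetrized_coboundary_mult[where c = c, OF h(1) bilinear_cocyclesD(1)[OF c] p] p by (simp add: h(2))
    finally show ?thesis .
  qed
  \<comment> \<open>From left to right, the condition is evaluated on
    \<open>bilinear_extension c\<close> at elements with trivial first coordinate, where
    \<open>i\<close> is visibly injective. From right to left, \<open>commutator\<close> handles
    every extension.\<close>
  have wedge: "(\<forall>(E :: ('b \<times> 'a) monoid) i p.
        central_extension A B E i p \<and> has_extension_class A B E i p (coh_class A B c) \<longrightarrow>
        (\<forall>x \<in> carrier E. \<forall>y \<in> carrier E. i (h (wedge A (p x) (p y))) = group_commutator E x y))
    \<longleftrightarrow> (\<forall>x \<in> carrier A. \<forall>y \<in> carrier A. h (wedge A x y) = ?d x y)" (is "?l \<longleftrightarrow> ?r") for h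
  proof
    assume l: ?l
    show ?r
    proof (intro ballI)
      fix x y assume xy: "x \<in> carrier A" "y \<in> carrier A"
      then have E: "(\<one>\<^bsub>B\<^esub>, x) \<in> carrier ?E" "(\<one>\<^bsub>B\<^esub>, y) \<in> carrier ?E"
        by (auto simp: bilinear_extension_def)
      from l[rule_format, OF conjI[OF central_extension_bilinear_extension[OF c]] E]
      show "h (wedge A x y) = ?d x y"
        using commutator[OF central_extension_bilinear_extension[OF c] E] by simp
    qed
  next
    assume r: ?r
    show ?l
    proof (intro allI impI ballI, elim conjE)
      fix E :: "('b \<times> 'a) monoid" and i p x y
      assume E: "central_extension A B E i p" and cls: "has_extension_class A B E i p (coh_class A B c)"
        and xy: "x \<in> carrier E" "y \<in> carrier E"
      interpret E: central_extension A B E i p by fact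
      have "p x \<in> carrier A" "p y \<in> carrier A"
        using xy E.p_epi by (auto simp: epi_def hom_def)
      then show "i (h (wedge A (p x) (p y))) = group_commutator E x y"
        using r commutator[OF E cls xy] by simp
    qed
  qed
  show ?thesis unfolding mu_def wedge ..
qed

text \<open>The defining description of \<open>antisymmetrization\<close> consults \<open>f\<close>
  on pure tensors only, where it agrees with \<open>c\<close>.\<close>

lemma antisymmetrization_eq:
  assumes "\<And>x y. \<lbrakk>x \<in> carrier A; y \<in> carrier A\<rbrakk> \<Longrightarrow> f (tensor A x y) = c (x, y)"
  shows "antisymmetrization A B f = (THE h.
     h \<in> hom (exterior_square A) B \<inter> extensional (carrier (exterior_square A)) \<and>
     (\<forall>x \<in> carrier A. \<forall>y \<in> carrier A. h (wedge A x y) = c (x, y) \<otimes>\<^bsub>B\<^esub> inv\<^bsub>B\<^esub> c (y, x)))"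
  unfolding antisymmetrization_def using assms by (intro arg_cong[where f = The] ext) auto

lemma tensor_mult:
  assumes "x \<in> carrier A" "y \<in> carrier A" "z \<in> carrier A"
  shows "tensor A (x \<otimes>\<^bsub>A\<^esub> y) z = tensor A x z \<otimes>\<^bsub>tensor_square A\<^esub> tensor A y z"
    and "tensor A x (y \<otimes>\<^bsub>A\<^esub> z) = tensor A x y \<otimes>\<^bsub>tensor_square A\<^esub> tensor A x z"
proof -
  let ?F = "free_Abelian_group (carrier A \<times> carrier A)" and ?K = "tensor_kernel A"
  interpret F: comm_group ?F by (rule abelian_free_Abelian_group)
  interpret K: normal ?K ?F by (rule A.tensor_kernel_normal)
  \<comment> \<open>A relation \<open>p - q - r\<close> in the kernel puts \<open>p\<close> in the
    coset of \<open>q + r\<close>, and that coset is the product of those of \<open>q\<close> and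
    \<open>r\<close>.\<close>
  have eq: "?K #>\<^bsub>?F\<^esub> frag_of p = (?K #>\<^bsub>?F\<^esub> frag_of q) <#>\<^bsub>?F\<^esub> (?K #>\<^bsub>?F\<^esub> frag_of r)"
    if pqr: "p \<in> carrier A \<times> carrier A" "q \<in> carrier A \<times> carrier A" "r \<in> carrier A \<times> carrier A"
      and rel: "frag_of p - frag_of q - frag_of r \<in> tensor_relations A" for p q r
  proof -
    have in_F: "frag_of q + frag_of r \<in> carrier ?F"
      using F.m_closed[of "frag_of q" "frag_of r"] pqr by simp
    have "frag_of p - frag_of q - frag_of r \<in> ?K"
      using rel unfolding tensor_kernel_def by (rule generate.incl)
    then have "(frag_of p - frag_of q - frag_of r) \<otimes>\<^bsub>?F\<^esub> (frag_of q + frag_of r) \<in> ?K #>\<^bsub>?F\<^esub> (frag_of q + frag_of r)"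
      by (rule F.rcosI[OF _ K.subset in_F])
    then have "frag_of p \<in> ?K #>\<^bsub>?F\<^esub> (frag_of q + frag_of r)" by simp
    then have "?K #>\<^bsub>?F\<^esub> frag_of p = ?K #>\<^bsub>?F\<^esub> (frag_of q + frag_of r)"
      by (metis F.repr_independence K.subgroup_axioms in_F)
    then show ?thesis using K.rcos_sum[of "frag_of q" "frag_of r"] pqr by simp
  qed
  show "tensor A (x \<otimes>\<^bsub>A\<^esub> y) z = tensor A x z \<otimes>\<^bsub>tensor_square A\<^esub> tensor A y z"
    using assms unfolding tensor_def tensor_square_def mult_FactGroup
    by (intro eq) (auto simp only: tensor_relations_def mem_Sigma_iff A.m_closed intro!: UnI1)
  show "tensor A x (y \<otimes>\<^bsub>A\<^esub> z) = tensor A x y \<otimes>\<^bsub>tensor_square A\<^esub> tensor A x z"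
    using assms unfolding tensor_def tensor_square_def mult_FactGroup
    by (intro eq) (auto simp only: tensor_relations_def mem_Sigma_iff A.m_closed intro!: UnI2)
qed

text \<open>Homomorphisms on the tensor square and bilinear cocycles determine each other by
  evaluation on pure tensors, and for a corresponding pair the map
  \<open>antisymmetrization A B f\<close> equals \<open>mu\<close> of the class.\<close>

lemma epi_antisymmetrization_iff_epi_mu:
  "(\<exists>f \<in> hom (tensor_square A) B. antisymmetrization A B f \<in> epi (exterior_square A) B)
    \<longleftrightarrow> (\<exists>e \<in> H2b A B. mu A B e \<in> epi (exterior_square A) B)"
proof
  assume "\<exists>f \<in> hom (tensor_square A) B. antisymmetrization A B f \<in> epi (exterior_square A) B"
  then obtain f where f: "f \<in> hom (tensor_square A) B"
    "antisymmetrization A B f \<in> epi (exterior_square A) B" by blast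
  \<comment> \<open>The composite of \<open>f\<close> with the universal bilinear map.\<close>
  define c where "c = (\<lambda>(x, y) \<in> carrier A \<times> carrier A. f (tensor A x y))"
  have c: "c \<in> bilinear_cocycles"
    using f(1) A.tensor_closed
    by (auto simp: c_def bilinear_cocycles_def biadditive_def tensor_mult hom_def)
  have "antisymmetrization A B f = mu A B (coh_class A B c)"
    unfolding mu_coh_class[OF c] by (rule antisymmetrization_eq) (simp add: c_def)
  then show "\<exists>e \<in> H2b A B. mu A B e \<in> epi (exterior_square A) B"
    using f(2) c by (auto simp: H2b_eq)
next
  assume "\<exists>e \<in> H2b A B. mu A B e \<in> epi (exterior_square A) B"
  then obtain c where c: "c \<in> bilinear_cocycles" "mu A B (coh_class A B c) \<in> epi (exterior_square A) B"
    by (auto simp: H2b_eq)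
  obtain f where f: "f \<in> hom (tensor_square A) B"
    "\<And>x y. \<lbrakk>x \<in> carrier A; y \<in> carrier A\<rbrakk> \<Longrightarrow> f (tensor A x y) = c (x, y)"
    by (rule A.tensor_square_universal[of B "curry c"])
      (use c(1) B.comm_group_axioms in \<open>auto simp: bilinear_cocycles_def\<close>)
  have "antisymmetrization A B f = mu A B (coh_class A B c)"
    unfolding mu_coh_class[OF c(1)] by (rule antisymmetrization_eq) (rule f(2))
  then show "\<exists>f \<in> hom (tensor_square A) B. antisymmetrization A B f \<in> epi (exterior_square A) B"
    using f(1) c(2) by (intro bexI[of _ f]) simp_all
qed

end


section \<open>The equivalence\<close>

text \<open>\<open>U\<close> is surjective on objects and the identity on arrows, so choosing a
  preimage of each object gives a quasi-inverse that is also the identity on arrows.\<close>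

lemma equivalent_categories_if_same_morphisms:
  assumes C: "category C" and obj: "U ` obj D = obj C"
    and mor: "\<And>x y. \<lbrakk>x \<in> obj D; y \<in> obj D\<rbrakk> \<Longrightarrow> mor D x y = mor C (U x) (U y)"
    and ident: "\<And>x. x \<in> obj D \<Longrightarrow> ident D x = ident C (U x)"
    and cmp: "\<And>x y z. \<lbrakk>x \<in> obj D; y \<in> obj D; z \<in> obj D\<rbrakk> \<Longrightarrow> cmp D x y z = cmp C (U x) (U y) (U z)"
  shows "equivalent_categories C D"
proof -
  interpret C: category C by fact
  have U: "U x \<in> obj C" if "x \<in> obj D" for x using that obj by blast
  define F where "F = inv_into (obj D) U"
  have F: "F x \<in> obj D" "U (F x) = x" if "x \<in> obj C" for x
    using that obj by (auto simp: F_def inv_into_into f_inv_into_f)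
  interpret D: category D
    by unfold_locales (auto simp: mor ident cmp U C.ident_mor C.cmp_ident_left C.cmp_ident_right
        intro: C.cmp_mor C.cmp_assoc)
  have iso: "inverse_mors C x x (ident C x) (ident C x)" if "x \<in> obj C" for x
    using that by (simp add: inverse_mors_def C.ident_mor C.cmp_ident_left)
  \<comment> \<open>The object \<open>F (U x)\<close> may differ from \<open>x\<close>, but both
    have the same image under \<open>U\<close>; the identity of that image is an arrow between them
    in either direction.\<close>
  have iso': "inverse_mors D (F (U x)) x (ident C (U x)) (ident C (U x))" if "x \<in> obj D" for x
    using iso[OF U[OF that]] that by (simp add: inverse_mors_def F U mor cmp ident)
  show ?thesis
    unfolding equivalent_categories_def
  proof (intro exI conjI)
    show "cat_functor C D F (\<lambda>x y f. f)"
      by unfold_locales (simp_all add: F mor ident cmp)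
    show "cat_functor D C U (\<lambda>x y f. f)"
      by unfold_locales (simp_all add: U mor ident cmp)
    show "naturally_isomorphic C C (\<lambda>x. U (F x)) (\<lambda>x y f. f) (\<lambda>x. x) (\<lambda>x y f. f)"
      unfolding naturally_isomorphic_def
      by (rule exI[of _ "ident C"]) (use iso in \<open>auto simp: F C.cmp_ident_left C.cmp_ident_right\<close>)
    show "naturally_isomorphic D D (\<lambda>x. F (U x)) (\<lambda>x y f. f) (\<lambda>x. x) (\<lambda>x y f. f)"
      unfolding naturally_isomorphic_def
      by (rule exI[of _ "\<lambda>x. ident C (U x)"])
        (use iso' in \<open>auto simp: F U mor cmp C.cmp_ident_left C.cmp_ident_right\<close>)
  qed
qed

section \<open>The categories at hand, and their objects and arrows\<close>

lemma category_Ab: "category Ab"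
proof
  fix A :: "'a monoid" assume "A \<in> obj Ab"
  then show "ident Ab A \<in> mor Ab A A"
    by (auto simp: Ab_def concrete_cat_def hom_def comm_group_def comm_monoid_def monoid.m_closed)
next
  fix A B C :: "'a monoid" and f g
  assume "A \<in> obj Ab" "f \<in> mor Ab A B" "g \<in> mor Ab B C"
  then show "cmp Ab A B C g f \<in> mor Ab A C"
    by (auto simp: Ab_def concrete_cat_def hom_def compose_def comm_group_def comm_monoid_def monoid.m_closed Pi_iff)
next
  fix A B :: "'a monoid" and f assume "f \<in> mor Ab A B"
  then show "cmp Ab A B B (ident Ab B) f = f" "cmp Ab A A B f (ident Ab A) = f"
    by (auto simp: Ab_def concrete_cat_def compose_def hom_def intro!: extensionalityI[of _ "carrier A"])
next
  fix A B C D :: "'a monoid" and f g h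
  assume "f \<in> mor Ab A B"
  then show "cmp Ab A B D (cmp Ab B C D h g) f = cmp Ab A C D h (cmp Ab A B C g f)"
    by (auto simp: Ab_def concrete_cat_def hom_def intro!: compose_assoc[symmetric])
qed

lemma category_prod_cat:
  assumes "category C" "category D"
  shows "category (prod_cat C D)"
proof -
  interpret C: category C by fact
  interpret D: category D by fact
  show ?thesis
    by unfold_locales
      (auto simp: prod_cat_def C.ident_mor D.ident_mor C.cmp_ident_left D.cmp_ident_left
        C.cmp_ident_right D.cmp_ident_right intro: C.cmp_mor D.cmp_mor C.cmp_assoc D.cmp_assoc)
qed

lemma category_full_subcat:
  assumes "category C"
  shows "category (full_subcat C S)"
proof -
  interpret C: category C by fact
  show ?thesis
    by unfold_locales
      (auto simp: full_subcat_def C.ident_mor C.cmp_ident_left C.cmp_ident_right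
        intro: C.cmp_mor C.cmp_assoc)
qed

lemma obj_Spl_iff:
  "(A, B) \<in> obj Spl \<longleftrightarrow> comm_group A \<and> comm_group B \<and>
     (\<exists>f \<in> hom (tensor_square A) B. antisymmetrization A B f \<in> epi (exterior_square A) B)"
  by (auto simp: Spl_def full_subcat_def prod_cat_def Ab_def concrete_cat_def)

lemma obj_Splab_iff:
  "(A, B, e) \<in> obj Splab \<longleftrightarrow> comm_group A \<and> comm_group B \<and> e \<in> H2b A B \<and>
     mu A B e \<in> epi (exterior_square A) B"
proof -
  have "H2b A B \<subseteq> carrier (H2 A B)" if "comm_group A" "comm_group B"
    using abelian_group_pair.H2b_subgroup[OF abelian_group_pair.intro[OF that]] by (rule subgroup.subset)
  then show ?thesis
    by (auto simp: Splab_def full_subcat_def Niqab_def)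
qed

text \<open>Pullback and pushforward both land in the subgroup \<open>H2b A B'\<close>, hence so
  does their difference, and every pair of homomorphisms is an arrow.\<close>

lemma mor_Splab:
  assumes "(A, B, e) \<in> obj Splab" "(A', B', e') \<in> obj Splab"
  shows "mor Splab (A, B, e) (A', B', e') = mor Ab A A' \<times> mor Ab B B'"
proof -
  have "H2_pullback A B' f e' \<otimes>\<^bsub>H2 A B'\<^esub> inv\<^bsub>H2 A B'\<^esub> H2_pushforward A B' g e \<in> H2b A B'"
    if "f \<in> mor Ab A A'" "g \<in> mor Ab B B'" for f g
  proof -
    have pair: "abelian_group_pair A B'" "abelian_group_pair A' B'" "abelian_group_pair A B"
      using assms by (auto simp: obj_Splab_iff intro: abelian_group_pair.intro)
    interpret abelian_group_pair A B' by fact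
    interpret H: comm_group "H2 A B'" by (rule H2_comm_group)
    interpret S: subgroup "H2b A B'" "H2 A B'" by (rule H2b_subgroup)
    show ?thesis
      using that assms H2_pullback_H2b[OF pair(1,2)] H2_pushforward_H2b[OF pair(3,1)]
      by (auto simp: obj_Splab_iff Ab_def concrete_cat_def)
  qed
  then show ?thesis
    by (auto simp: Splab_def full_subcat_def Niqab_def)
qed

lemma equivalent_categories_Spl_Splab:
  "equivalent_categories
     (Spl :: ('a monoid \<times> 'b monoid, ('a \<Rightarrow> 'a) \<times> ('b \<Rightarrow> 'b)) cat)
     (Splab :: ('a monoid \<times> 'b monoid \<times> ('a \<times> 'a \<Rightarrow> 'b) set, ('a \<Rightarrow> 'a) \<times> ('b \<Rightarrow> 'b)) cat)"
proof (rule equivalent_categories_if_same_morphisms[where U = "\<lambda>(A, B, e). (A, B)"])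
  show "category (Spl :: ('a monoid \<times> 'b monoid, ('a \<Rightarrow> 'a) \<times> ('b \<Rightarrow> 'b)) cat)"
    unfolding Spl_def by (intro category_full_subcat category_prod_cat category_Ab)
  \<comment> \<open>Surjectivity of the forgetful map on objects is the comparison of
    \<open>antisymmetrization\<close> and \<open>mu\<close>.\<close>
  have "(A, B) \<in> obj Spl \<longleftrightarrow> (\<exists>e. (A, B, e) \<in> obj Splab)" for A :: "'a monoid" and B :: "'b monoid"
    using abelian_group_pair.epi_antisymmetrization_iff_epi_mu[OF abelian_group_pair.intro, of A B]
    by (auto simp: obj_Spl_iff obj_Splab_iff)
  then show "(\<lambda>(A, B, e). (A, B)) ` obj Splab = obj (Spl :: ('a monoid \<times> 'b monoid, _) cat)"
    by (force simp: image_iff)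
qed (auto simp: mor_Splab, auto simp: Spl_def Splab_def Niqab_def full_subcat_def prod_cat_def fun_eq_iff)


section \<open>q-maps between nil2-groups\<close>

text \<open>The image of the derived subgroup is the derived subgroup of the image, which is trivial
  in a commutative group.\<close>

lemma (in group) hom_comm_group_derived:
  assumes K: "comm_group K" and h: "h \<in> hom G K" and d: "d \<in> comm_sub G"
  shows "h d = \<one>\<^bsub>K\<^esub>"
proof -
  interpret K: comm_group K by fact
  interpret h: group_hom G K h
    using h K.is_group by (simp add: group_hom_def group_hom_axioms_def is_group)
  have "h ` comm_sub G = derived K (h ` carrier G)"
    by (rule h.derived_img[symmetric]) simp
  also have "\<dots> = {\<one>\<^bsub>K\<^esub>}" by (rule K.derived_eq_singleton) auto
  finally show ?thesis using d by blast
qed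

locale nil2 = group G for G (structure) +
  assumes nil2: "commutator_subgroup G (comm_sub G) (carrier G) = {\<one>}"

lemma nil2_iff: "nil2 G \<longleftrightarrow> nil2_group G"
  by (simp add: nil2_def nil2_axioms_def nil2_group_def)

context nil2
begin

abbreviation D where "D \<equiv> comm_sub G"
abbreviation Gab where "Gab \<equiv> abelianization G"

sublocale D: normal D G
  by (rule derived_self_is_normal)

sublocale Gab: comm_group Gab
  unfolding abelianization_def by (rule derived_quot_is_comm_group)

lemma coset_hom: "(\<lambda>x. D #> x) \<in> hom G Gab"
  unfolding abelianization_def by (rule D.r_coset_hom_Mod)

sublocale ab: group_hom G Gab "\<lambda>x. D #> x"
  using coset_hom by (simp add: group_hom_def group_hom_axioms_def is_group Gab.is_group)

lemma carrier_Gab: "carrier Gab = (\<lambda>x. D #> x) ` carrier G"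
  by (simp add: abelianization_def carrier_FactGroup)

lemma one_Gab: "\<one>\<^bsub>Gab\<^esub> = D"
  by (simp add: abelianization_def)

lemma coset_eq_one_iff: "x \<in> carrier G \<Longrightarrow> D #> x = \<one>\<^bsub>Gab\<^esub> \<longleftrightarrow> x \<in> D"
  using coset_join1[OF _ _ D.subgroup_axioms] coset_join2[OF _ D.subgroup_axioms]
  by (auto simp: one_Gab)

text \<open>The commutator of \<open>d\<close> and \<open>g\<close> is a generator of a subgroup
  that is trivial by nilpotency.\<close>

lemma D_central:
  assumes d: "d \<in> D" and g: "g \<in> carrier G"
  shows "d \<otimes> g = g \<otimes> d"
proof -
  have dG: "d \<in> carrier G" using d by (rule D.mem_carrier)
  have "group_commutator G d g \<in> commutator_subgroup G D (carrier G)"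
    unfolding commutator_subgroup_def using d g by (intro generate.incl) blast
  then have "inv d \<otimes> inv g \<otimes> d \<otimes> g = \<one>" by (simp add: nil2 group_commutator_def)
  then have "inv (g \<otimes> d) \<otimes> (d \<otimes> g) = \<one>"
    using dG g by (simp add: inv_mult_group m_assoc)
  then show ?thesis
    using dG g by (metis inv_solve_left m_closed one_closed r_one)
qed

lemma D_comm_group: "comm_group (G\<lparr>carrier := D\<rparr>)"
proof (rule group.group_comm_groupI)
  show "group (G\<lparr>carrier := D\<rparr>)" by (rule subgroup_imp_group[OF D.subgroup_axioms])
qed (simp add: D_central D.mem_carrier)

end

lemma iso_by_inverse_homs:
  assumes f: "f \<in> hom A B" and g: "g \<in> hom B A"
    and "\<And>x. x \<in> carrier A \<Longrightarrow> g (f x) = x" "\<And>y. y \<in> carrier B \<Longrightarrow> f (g y) = y"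
  shows "A \<cong> B"
proof -
  have "bij_betw f (carrier A) (carrier B)"
    by (rule bij_betw_byWitness[of _ g]) (use assms in \<open>auto simp: hom_def\<close>)
  then show ?thesis using f by (auto simp: is_iso_def iso_def)
qed

locale nil2_q_map = G: nil2 G + H: nil2 H
  for G :: "('a, 'm) monoid_scheme" and H :: "('b, 'n) monoid_scheme" +
  fixes f
  assumes q_map: "f \<in> q_maps G H"
begin

lemma f_closed [simp]: "x \<in> carrier G \<Longrightarrow> f x \<in> carrier H"
  using q_map by (auto simp: q_maps_def weakly_quadratic_def)

lemma cross_effect_D: "\<lbrakk>x \<in> carrier G; y \<in> carrier G\<rbrakk> \<Longrightarrow> cross_effect G H f x y \<in> H.D"
  using q_map by (auto simp: q_maps_def)

lemma f_mult:
  assumes "x \<in> carrier G" "y \<in> carrier G"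
  shows "f (x \<otimes>\<^bsub>G\<^esub> y) = f x \<otimes>\<^bsub>H\<^esub> f y \<otimes>\<^bsub>H\<^esub> cross_effect G H f x y"
  using assms by (simp add: cross_effect_def H.m_assoc[symmetric] H.r_inv)

text \<open>Cross effects of a q-map are products of commutators and disappear in the
  abelianization.\<close>

lemma coset_f_hom: "(\<lambda>x. H.D #>\<^bsub>H\<^esub> f x) \<in> hom G H.Gab"
proof (rule homI)
  fix x y assume xy: "x \<in> carrier G" "y \<in> carrier G"
  have "H.D #>\<^bsub>H\<^esub> cross_effect G H f x y = \<one>\<^bsub>H.Gab\<^esub>"
    using cross_effect_D[OF xy] by (simp add: H.coset_eq_one_iff H.D.mem_carrier)
  then show "H.D #>\<^bsub>H\<^esub> f (x \<otimes>\<^bsub>G\<^esub> y) = (H.D #>\<^bsub>H\<^esub> f x) \<otimes>\<^bsub>H.Gab\<^esub> (H.D #>\<^bsub>H\<^esub> f y)"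
    using xy cross_effect_D[OF xy] by (simp add: f_mult H.D.mem_carrier)
qed simp

text \<open>The homomorphism of \<open>coset_f_hom\<close> has a commutative target and so kills
  \<open>G.D\<close>; a trivial coset of \<open>f d\<close> means that \<open>f d\<close> lies in
  \<open>H.D\<close>.\<close>

lemma f_D: "d \<in> G.D \<Longrightarrow> f d \<in> H.D"
  using G.hom_comm_group_derived[OF H.Gab.comm_group_axioms coset_f_hom]
  by (simp add: H.coset_eq_one_iff G.D.mem_carrier)

text \<open>The cross effect is additive with values in an abelian group, so it vanishes on commutators.\<close>

lemma f_mult_D:
  assumes d: "d \<in> G.D" and x: "x \<in> carrier G"
  shows "f (d \<otimes>\<^bsub>G\<^esub> x) = f d \<otimes>\<^bsub>H\<^esub> f x"
proof -
  have "(\<lambda>a. cross_effect G H f a x) \<in> hom G (H\<lparr>carrier := H.D\<rparr>)"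
    using q_map x by (auto simp: q_maps_def weakly_quadratic_def biadditive_def hom_def)
  from G.hom_comm_group_derived[OF H.D_comm_group this d]
  show ?thesis using d x by (simp add: f_mult G.D.mem_carrier)
qed

lemma f_hom_D: "f \<in> hom (G\<lparr>carrier := G.D\<rparr>) (H\<lparr>carrier := H.D\<rparr>)"
  by (auto simp: hom_def f_D f_mult_D G.D.mem_carrier)

lemma abelianized_hom:
  obtains h where "h \<in> hom G.Gab H.Gab" "\<And>x. x \<in> carrier G \<Longrightarrow> h (G.D #>\<^bsub>G\<^esub> x) = H.D #>\<^bsub>H\<^esub> f x"
proof -
  interpret h: group_hom G H.Gab "\<lambda>x. H.D #>\<^bsub>H\<^esub> f x"
    using coset_f_hom by (simp add: group_hom_def group_hom_axioms_def G.is_group H.Gab.is_group)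
  have "H.D #>\<^bsub>H\<^esub> f d = \<one>\<^bsub>H.Gab\<^esub>" if "d \<in> G.D" for d
    using f_D[OF that] that by (simp add: G.D.mem_carrier H.coset_eq_one_iff)
  then have "G.D \<subseteq> kernel G H.Gab (\<lambda>x. H.D #>\<^bsub>H\<^esub> f x)"
    by (simp add: kernel_def subset_iff G.D.mem_carrier)
  from h.FactGroup_universal_kernel[OF G.D.normal_axioms this] that show thesis
    unfolding abelianization_def[of G] by blast
qed

end

text \<open>The maps induced on abelianizations and the restrictions to commutator subgroups inherit
  the property of being mutually inverse.\<close>

lemma inverse_q_maps_imp_similar:
  assumes f: "nil2_q_map G H f" and g: "nil2_q_map H G g"
    and gf: "\<And>x. x \<in> carrier G \<Longrightarrow> g (f x) = x" and fg: "\<And>y. y \<in> carrier H \<Longrightarrow> f (g y) = y"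
  shows "similar_groups G H"
proof -
  interpret f: nil2_q_map G H f by fact
  interpret g: nil2_q_map H G g by fact
  obtain h where h: "h \<in> hom f.G.Gab f.H.Gab" "\<And>x. x \<in> carrier G \<Longrightarrow> h (f.G.D #>\<^bsub>G\<^esub> x) = f.H.D #>\<^bsub>H\<^esub> f x"
    using f.abelianized_hom by blast
  obtain k where k: "k \<in> hom f.H.Gab f.G.Gab" "\<And>x. x \<in> carrier H \<Longrightarrow> k (f.H.D #>\<^bsub>H\<^esub> x) = f.G.D #>\<^bsub>G\<^esub> g x"
    using g.abelianized_hom by blast
  have "f.G.Gab \<cong> f.H.Gab"
    using h(2) k(2) gf fg by (intro iso_by_inverse_homs[OF h(1) k(1)])
      (auto simp: f.G.carrier_Gab f.H.carrier_Gab)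
  moreover have "G\<lparr>carrier := f.G.D\<rparr> \<cong> H\<lparr>carrier := f.H.D\<rparr>"
    by (rule iso_by_inverse_homs[OF f.f_hom_D g.f_hom_D])
      (simp_all add: gf fg f.G.D.mem_carrier f.H.D.mem_carrier)
  ultimately show ?thesis by (simp add: similar_groups_def)
qed

section \<open>Coordinates given by a quadratic section\<close>

locale q_split_group = nil2 +
  fixes s
  assumes s_quadratic: "quadratic Gab G s"
    and s_section: "X \<in> carrier Gab \<Longrightarrow> D #> s X = X"
begin

lemma s_closed [simp]: "X \<in> carrier Gab \<Longrightarrow> s X \<in> carrier G"
  using s_quadratic by (auto simp: quadratic_def weakly_quadratic_def)

abbreviation ce where "ce \<equiv> cross_effect Gab G s"

lemma ce_biadditive: "biadditive Gab G ce"
  using s_quadratic by (simp add: quadratic_def weakly_quadratic_def)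

text \<open>Modulo \<open>D\<close> the section becomes the identity, which is additive, so its
  cross effect becomes trivial.\<close>

lemma ce_D:
  assumes "X \<in> carrier Gab" "Y \<in> carrier Gab"
  shows "ce X Y \<in> D"
proof -
  have "ce X Y \<in> carrier G" using assms by (simp add: cross_effect_def)
  moreover have "D #> ce X Y = \<one>\<^bsub>Gab\<^esub>"
    using assms by (simp add: cross_effect_def s_section)
  ultimately show ?thesis by (simp add: coset_eq_one_iff)
qed

lemma s_mult:
  assumes "X \<in> carrier Gab" "Y \<in> carrier Gab"
  shows "s (X \<otimes>\<^bsub>Gab\<^esub> Y) = s X \<otimes> s Y \<otimes> ce X Y"
  using assms by (simp add: cross_effect_def m_assoc[symmetric])

text \<open>The commutator coordinate of \<open>a\<close>, complementing the coordinate
  \<open>D #> a\<close>.\<close>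

definition \<beta> where "\<beta> a = inv s (D #> a) \<otimes> a"

lemma \<beta>_D: "a \<in> carrier G \<Longrightarrow> \<beta> a \<in> D"
proof -
  assume a: "a \<in> carrier G"
  then have "\<beta> a \<in> carrier G" by (simp add: \<beta>_def)
  moreover have "D #> \<beta> a = \<one>\<^bsub>Gab\<^esub>" using a by (simp add: \<beta>_def s_section)
  ultimately show ?thesis by (simp add: coset_eq_one_iff)
qed

lemma s_\<beta>: "a \<in> carrier G \<Longrightarrow> s (D #> a) \<otimes> \<beta> a = a"
  by (simp add: \<beta>_def m_assoc[symmetric])

text \<open>Uniqueness of the decomposition: passing to cosets removes \<open>d\<close> and recovers
  \<open>X\<close>, after which \<open>s X\<close> can be cancelled.\<close>

lemma s_mult_unique:
  assumes "X \<in> carrier Gab" "d \<in> D"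
  shows "D #> (s X \<otimes> d) = X" "\<beta> (s X \<otimes> d) = d"
proof -
  have d: "d \<in> carrier G" using assms(2) by (rule D.mem_carrier)
  then show *: "D #> (s X \<otimes> d) = X"
    using assms coset_eq_one_iff[OF d] by (simp add: s_section)
  show "\<beta> (s X \<otimes> d) = d"
    using assms(1) d by (simp add: \<beta>_def * m_assoc[symmetric])
qed

text \<open>Commutators are central and can be collected on the right. Replacing the product of two
  values of the section by the value at the product introduces a cross effect, which the commutator
  coordinate has to compensate.\<close>

lemma \<beta>_mult:
  assumes a: "a \<in> carrier G" and b: "b \<in> carrier G"
  shows "\<beta> (a \<otimes> b) = \<beta> a \<otimes> \<beta> b \<otimes> inv ce (D #> a) (D #> b)"
proof -
  let ?X = "D #> a" and ?Y = "D #> b"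
  have X: "?X \<in> carrier Gab" "?Y \<in> carrier Gab" using a b by auto
  note cl = \<beta>_D[OF a] \<beta>_D[OF b] ce_D[OF X]
  note clG = cl[THEN D.mem_carrier]
  have "a \<otimes> b = (s ?X \<otimes> \<beta> a) \<otimes> (s ?Y \<otimes> \<beta> b)"
    using a b by (simp only: s_\<beta>)
  also have "\<dots> = s ?X \<otimes> (\<beta> a \<otimes> s ?Y) \<otimes> \<beta> b"
    using X clG by (simp add: m_assoc)
  also have "\<dots> = s ?X \<otimes> s ?Y \<otimes> (\<beta> a \<otimes> \<beta> b)"
    using X clG by (simp add: D_central[OF cl(1)] m_assoc)
  \<comment> \<open>A trivial factor is inserted so that \<open>s_mult\<close> can be applied
    backwards.\<close>
  also have "\<dots> = s ?X \<otimes> s ?Y \<otimes> (ce ?X ?Y \<otimes> inv ce ?X ?Y) \<otimes> (\<beta> a \<otimes> \<beta> b)"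
    using X clG by simp
  also have "\<dots> = s ?X \<otimes> s ?Y \<otimes> ce ?X ?Y \<otimes> (inv ce ?X ?Y \<otimes> (\<beta> a \<otimes> \<beta> b))"
    using X clG by (simp only: m_assoc m_closed inv_closed s_closed)
  also have "inv ce ?X ?Y \<otimes> (\<beta> a \<otimes> \<beta> b) = \<beta> a \<otimes> \<beta> b \<otimes> inv ce ?X ?Y"
    using clG by (intro D_central D.m_inv_closed cl) simp
  also have "s ?X \<otimes> s ?Y \<otimes> ce ?X ?Y = s (?X \<otimes>\<^bsub>Gab\<^esub> ?Y)"
    using X by (simp only: s_mult)
  finally show ?thesis
    using s_mult_unique(2)[of "?X \<otimes>\<^bsub>Gab\<^esub> ?Y" "\<beta> a \<otimes> \<beta> b \<otimes> inv ce ?X ?Y"] X cl by simp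
qed

end

text \<open>Relative to the sections, \<open>a \<mapsto> (D #> a, \<beta> a)\<close> identifies each group with the product
  set \<open>Gab \<times> D\<close>, and \<open>\<phi>\<close> and \<open>\<psi>\<close> act on the two coordinates.\<close>

definition coordinatewise_map where
  "coordinatewise_map G H s t \<phi> \<psi> =
     (\<lambda>a \<in> carrier G. t (\<phi> (comm_sub G #>\<^bsub>G\<^esub> a)) \<otimes>\<^bsub>H\<^esub> \<psi> (q_split_group.\<beta> G s a))"

text \<open>The failure of additivity has one contribution from each section. Both are bilinear,
  since \<phi> and \<psi> are homomorphisms, and both take values in the central subgroup
  \<open>H.D\<close>.\<close>

lemma coordinatewise_q_map:
  assumes "q_split_group G s" "q_split_group H t"
    and \<phi>: "\<phi> \<in> hom (abelianization G) (abelianization H)"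
    and \<psi>: "\<psi> \<in> hom (G\<lparr>carrier := comm_sub G\<rparr>) (H\<lparr>carrier := comm_sub H\<rparr>)"
  shows "coordinatewise_map G H s t \<phi> \<psi> \<in> q_maps G H"
proof -
  interpret G: q_split_group G s by fact
  interpret H: q_split_group H t by fact
  interpret \<phi>: group_hom G.Gab H.Gab \<phi>
    using \<phi> by (simp add: group_hom_def group_hom_axioms_def G.Gab.is_group H.Gab.is_group)
  interpret DG: comm_group "G\<lparr>carrier := G.D\<rparr>" by (rule G.D_comm_group)
  interpret DH: comm_group "H\<lparr>carrier := H.D\<rparr>" by (rule H.D_comm_group)
  interpret \<psi>: group_hom "G\<lparr>carrier := G.D\<rparr>" "H\<lparr>carrier := H.D\<rparr>" \<psi>
    using \<psi> by (simp add: group_hom_def group_hom_axioms_def DG.is_group DH.is_group)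
  have \<psi>_D: "\<psi> d \<in> H.D" if "d \<in> G.D" for d using \<psi>.hom_closed that by simp
  have \<psi>_mult: "\<psi> (d \<otimes>\<^bsub>G\<^esub> e) = \<psi> d \<otimes>\<^bsub>H\<^esub> \<psi> e" if "d \<in> G.D" "e \<in> G.D" for d e
    using \<psi>.hom_mult[of d e] that by simp
  have \<psi>_inv: "\<psi> (inv\<^bsub>G\<^esub> d) = inv\<^bsub>H\<^esub> \<psi> d" if "d \<in> G.D" for d
    using \<psi>.hom_inv[of d] that \<psi>_D
    by (simp add: G.m_inv_consistent[OF G.D.subgroup_axioms] H.m_inv_consistent[OF H.D.subgroup_axioms])
  define F where "F = coordinatewise_map G H s t \<phi> \<psi>"
  define X where "X a = G.D #>\<^bsub>G\<^esub> a" for a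
  have X [simp]: "X a \<in> carrier G.Gab" if "a \<in> carrier G" for a using that by (simp add: X_def)
  have X_mult: "X (a \<otimes>\<^bsub>G\<^esub> b) = X a \<otimes>\<^bsub>G.Gab\<^esub> X b" if "a \<in> carrier G" "b \<in> carrier G" for a b
    using that by (simp add: X_def)
  have F: "F a = t (\<phi> (X a)) \<otimes>\<^bsub>H\<^esub> \<psi> (G.\<beta> a)" if "a \<in> carrier G" for a
    using that by (simp add: F_def coordinatewise_map_def X_def)
  have FH: "F a \<in> carrier H" if "a \<in> carrier G" for a
    using that \<psi>_D[OF G.\<beta>_D[OF that]] by (simp add: F H.D.mem_carrier)
  \<comment> \<open>The first factor arises from \<open>H.s_mult\<close>, the second from applying
    \<psi> to the correction term in \<open>G.\<beta>_mult\<close>.\<close>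
  define \<kappa> where "\<kappa> a b = H.ce (\<phi> (X a)) (\<phi> (X b)) \<otimes>\<^bsub>H\<^esub> inv\<^bsub>H\<^esub> \<psi> (G.ce (X a) (X b))" for a b
  have \<kappa>: "\<kappa> a b \<in> H.D" if "a \<in> carrier G" "b \<in> carrier G" for a b
    using that by (simp add: \<kappa>_def H.ce_D \<psi>_D G.ce_D)
  have F_mult: "F (a \<otimes>\<^bsub>G\<^esub> b) = F a \<otimes>\<^bsub>H\<^esub> F b \<otimes>\<^bsub>H\<^esub> \<kappa> a b" if a: "a \<in> carrier G" and b: "b \<in> carrier G" for a b
  proof -
    let ?u = "t (\<phi> (X a))" and ?v = "t (\<phi> (X b))" and ?d = "\<psi> (G.\<beta> a)" and ?e = "\<psi> (G.\<beta> b)"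
      and ?c = "H.ce (\<phi> (X a)) (\<phi> (X b))" and ?k = "inv\<^bsub>H\<^esub> \<psi> (G.ce (X a) (X b))"
    have D: "?d \<in> H.D" "?e \<in> H.D" "?c \<in> H.D" "?k \<in> H.D"
      using a b by (auto simp: \<psi>_D G.\<beta>_D H.ce_D G.ce_D)
    note H = D[THEN H.D.mem_carrier]
    have uv: "?u \<in> carrier H" "?v \<in> carrier H" using a b by auto
    have "F (a \<otimes>\<^bsub>G\<^esub> b) = (?u \<otimes>\<^bsub>H\<^esub> ?v \<otimes>\<^bsub>H\<^esub> ?c) \<otimes>\<^bsub>H\<^esub> (?d \<otimes>\<^bsub>H\<^esub> ?e \<otimes>\<^bsub>H\<^esub> ?k)"
      using a b by (simp add: F X_mult H.s_mult G.\<beta>_mult[folded X_def] \<psi>_mult \<psi>_inv G.\<beta>_D G.ce_D)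
    also have "\<dots> = ?u \<otimes>\<^bsub>H\<^esub> ?v \<otimes>\<^bsub>H\<^esub> (?c \<otimes>\<^bsub>H\<^esub> (?d \<otimes>\<^bsub>H\<^esub> ?e)) \<otimes>\<^bsub>H\<^esub> ?k"
      using uv H by (simp add: H.m_assoc)
    also have "\<dots> = ?u \<otimes>\<^bsub>H\<^esub> (?v \<otimes>\<^bsub>H\<^esub> ?d) \<otimes>\<^bsub>H\<^esub> ?e \<otimes>\<^bsub>H\<^esub> (?c \<otimes>\<^bsub>H\<^esub> ?k)"
      using uv H by (simp add: H.D_central[OF D(3)] H.m_assoc)
    also have "\<dots> = (?u \<otimes>\<^bsub>H\<^esub> ?d) \<otimes>\<^bsub>H\<^esub> (?v \<otimes>\<^bsub>H\<^esub> ?e) \<otimes>\<^bsub>H\<^esub> (?c \<otimes>\<^bsub>H\<^esub> ?k)"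
      using uv H by (simp add: H.D_central[OF D(1) uv(2), symmetric] H.m_assoc)
    finally show ?thesis using a b by (simp add: F \<kappa>_def)
  qed
  have cross: "cross_effect G H F a b = \<kappa> a b" if a: "a \<in> carrier G" and b: "b \<in> carrier G" for a b
    using a b FH \<kappa>[OF a b, THEN H.D.mem_carrier]
    by (simp add: cross_effect_def F_mult H.inv_solve_left')
  have "biadditive G H \<kappa>"
  proof -
    \<comment> \<open>Additivity of a quotient of two additive maps, where the values commute
      because \<open>H.D\<close> is central.\<close>
    have swap: "c \<otimes>\<^bsub>H\<^esub> c' \<otimes>\<^bsub>H\<^esub> inv\<^bsub>H\<^esub> (k \<otimes>\<^bsub>H\<^esub> k') = c \<otimes>\<^bsub>H\<^esub> inv\<^bsub>H\<^esub> k \<otimes>\<^bsub>H\<^esub> (c' \<otimes>\<^bsub>H\<^esub> inv\<^bsub>H\<^esub> k')"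
      if "c \<in> H.D" "c' \<in> H.D" "k \<in> H.D" "k' \<in> H.D" for c c' k k'
    proof -
      have G: "c \<in> carrier H" "c' \<in> carrier H" "k \<in> carrier H" "k' \<in> carrier H"
        using that by (auto simp: H.D.mem_carrier)
      show ?thesis
        using G H.D_central[OF H.D.m_inv_closed[OF that(3)], of "c' \<otimes>\<^bsub>H\<^esub> inv\<^bsub>H\<^esub> k'"]
        by (simp add: H.inv_mult_group H.m_assoc)
    qed
    show ?thesis
      using G.ce_biadditive H.ce_biadditive
      by (auto simp: biadditive_def \<kappa>_def X_mult \<psi>_mult G.ce_D H.ce_D \<psi>_D swap)
  qed
  then have "biadditive G H (cross_effect G H F)"
    using cross by (simp add: biadditive_def)
  then show ?thesis
    unfolding F_def[symmetric] q_maps_def weakly_quadratic_def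
    using FH by (auto simp: cross \<kappa> H.D_central)
qed

text \<open>By uniqueness of the decomposition the image of \<open>a\<close> has coordinates given
  by \<phi> and \<psi>; the second map undoes these, and \<open>G.s_\<beta>\<close> reassembles
  \<open>a\<close>.\<close>

lemma coordinatewise_map_inverse:
  assumes "q_split_group G s" "q_split_group H t"
    and "\<phi> \<in> carrier (abelianization G) \<rightarrow> carrier (abelianization H)"
    and "\<psi> \<in> comm_sub G \<rightarrow> comm_sub H"
    and "\<And>X. X \<in> carrier (abelianization G) \<Longrightarrow> \<phi>' (\<phi> X) = X"
    and "\<And>d. d \<in> comm_sub G \<Longrightarrow> \<psi>' (\<psi> d) = d"
  shows "compose (carrier G) (coordinatewise_map H G t s \<phi>' \<psi>') (coordinatewise_map G H s t \<phi> \<psi>)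
    = (\<lambda>a \<in> carrier G. a)"
  unfolding compose_def
proof (rule restrict_ext)
  interpret G: q_split_group G s by fact
  interpret H: q_split_group H t by fact
  fix a assume a: "a \<in> carrier G"
  let ?X = "G.D #>\<^bsub>G\<^esub> a"
  have X: "?X \<in> carrier G.Gab" using a by simp
  then have \<phi>X: "\<phi> ?X \<in> carrier H.Gab" using assms(3) by blast
  have \<psi>d: "\<psi> (G.\<beta> a) \<in> H.D" using assms(4) G.\<beta>_D[OF a] by blast
  show "coordinatewise_map H G t s \<phi>' \<psi>' (coordinatewise_map G H s t \<phi> \<psi> a) = a"
    using a \<phi>X \<psi>d H.s_mult_unique[OF \<phi>X \<psi>d] assms(5)[OF X] assms(6)[OF G.\<beta>_D[OF a]]
    by (simp add: coordinatewise_map_def H.D.mem_carrier G.s_\<beta>)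
qed

lemma q_split_isomorphic_in_Niq_iff:
  fixes G H :: "'g monoid"
  assumes "nil2_group G" "q_split G" "nil2_group H" "q_split H"
  shows "isomorphic_in Niq G H \<longleftrightarrow> similar_groups G H"
proof
  assume "isomorphic_in Niq G H"
  then obtain f g where fg: "f \<in> q_maps G H" "g \<in> q_maps H G"
    "compose (carrier G) g f = (\<lambda>a \<in> carrier G. a)" "compose (carrier H) f g = (\<lambda>a \<in> carrier H. a)"
    by (auto simp: isomorphic_in_def inverse_mors_def Niq_def concrete_cat_def)
  have "nil2_q_map G H f" "nil2_q_map H G g"
    using assms fg(1,2) by (simp_all add: nil2_q_map_def nil2_q_map_axioms_def nil2_iff)
  moreover have "g (f x) = x" if "x \<in> carrier G" for x
    using fun_cong[OF fg(3), of x] that by (simp add: compose_def)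
  moreover have "f (g x) = x" if "x \<in> carrier H" for x
    using fun_cong[OF fg(4), of x] that by (simp add: compose_def)
  ultimately show "similar_groups G H" by (rule inverse_q_maps_imp_similar)
next
  assume sim: "similar_groups G H"
  obtain s where s: "q_split_group G s"
    using assms(1,2) by (auto simp: q_split_def q_split_group_def q_split_group_axioms_def nil2_iff)
  obtain t where t: "q_split_group H t"
    using assms(3,4) by (auto simp: q_split_def q_split_group_def q_split_group_axioms_def nil2_iff)
  interpret G: q_split_group G s by fact
  interpret H: q_split_group H t by fact
  obtain \<phi> \<psi> where \<phi>: "\<phi> \<in> iso G.Gab H.Gab" and \<psi>: "\<psi> \<in> iso (G\<lparr>carrier := G.D\<rparr>) (H\<lparr>carrier := H.D\<rparr>)"
    using sim by (auto simp: similar_groups_def is_iso_def)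
  define \<phi>' where "\<phi>' = inv_into (carrier G.Gab) \<phi>"
  define \<psi>' where "\<psi>' = inv_into G.D \<psi>"
  have \<phi>': "\<phi>' \<in> iso H.Gab G.Gab"
    unfolding \<phi>'_def by (rule G.Gab.iso_set_sym[OF \<phi>])
  have \<psi>': "\<psi>' \<in> iso (H\<lparr>carrier := H.D\<rparr>) (G\<lparr>carrier := G.D\<rparr>)"
    using group.iso_set_sym[OF comm_group.axioms(2)[OF G.D_comm_group] \<psi>] by (simp add: \<psi>'_def)
  have bij: "bij_betw \<phi> (carrier G.Gab) (carrier H.Gab)" "bij_betw \<psi> G.D H.D"
    using \<phi> \<psi> by (auto simp: iso_def)
  \<comment> \<open>The inverse is the same construction with the two sections exchanged and both
    isomorphisms inverted.\<close>
  let ?f = "coordinatewise_map G H s t \<phi> \<psi>" and ?g = "coordinatewise_map H G t s \<phi>' \<psi>'"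
  have "?f \<in> q_maps G H" "?g \<in> q_maps H G"
    using \<phi> \<psi> \<phi>' \<psi>' by (auto simp: iso_def intro!: coordinatewise_q_map s t)
  moreover have "compose (carrier G) ?g ?f = (\<lambda>a \<in> carrier G. a)"
    using bij by (intro coordinatewise_map_inverse s t)
      (auto simp: \<phi>'_def \<psi>'_def bij_betw_def inv_into_f_f)
  moreover have "compose (carrier H) ?f ?g = (\<lambda>a \<in> carrier H. a)"
    using bij \<phi>' \<psi>' by (intro coordinatewise_map_inverse s t)
      (auto simp: \<phi>'_def \<psi>'_def bij_betw_def f_inv_into_f inv_into_into)
  ultimately have "inverse_mors Niq G H ?f ?g"
    by (auto simp: inverse_mors_def Niq_def concrete_cat_def coordinatewise_map_def)
  then show "isomorphic_in Niq G H"
    using assms by (auto simp: isomorphic_in_def Niq_def concrete_cat_def)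
qed

theorem theorem7p6:
  shows "equivalent_categories
           (Spl :: ('a monoid \<times> 'b monoid, ('a \<Rightarrow> 'a) \<times> ('b \<Rightarrow> 'b)) cat)
           (Splab :: ('a monoid \<times> 'b monoid \<times> ('a \<times> 'a \<Rightarrow> 'b) set,
              ('a \<Rightarrow> 'a) \<times> ('b \<Rightarrow> 'b)) cat)
       \<and> (\<forall>G H :: 'g monoid.
           nil2_group G \<and> q_split G \<and> nil2_group H \<and> q_split H
             \<longrightarrow> (isomorphic_in Niq G H \<longleftrightarrow> similar_groups G H))"
  using equivalent_categories_Spl_Splab q_split_isomorphic_in_Niq_iff by blast

end
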